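(* Let $X$ and $Y$ be random elements taking values in measurable spaces $\Omega_X,\Omega_Y$, and suppose $\{P_{X|Y}(\cdot\,|\,y):y\in\Omega_Y\}$ is dominated by a $\sigma$-finite measure. Let $\mathcal H_X$ and $\mathcal H_Y$ be Hilbert spaces of real functions on $\Omega_X$ and $\Omega_Y$ satisfying: (A) $\mathcal H_X$ and $\mathcal H_Y$ are dense subsets of $L_2(P_X)$ and $L_2(P_Y)$ modulo constants; (B) there are constants $C_1,C_2>0$ such that $\operatorname{var}[f(X)]\le C_1\|f\|_{\mathcal H_X}^2$ for all $f\in\mathcal H_X$ and $\operatorname{var}[g(Y)]\le C_2\|g\|_{\mathcal H_Y}^2$ for all $g\in\mathcal H_Y$. Let $E_{X|Y}:L_2(P_X)\to L_2(P_Y)$ be the conditional expectation operator. If the central class $\mathfrak S_{Y|X}$ is complete, then $$\overline{\operatorname{ran}}\bigl(E_{X|Y}^*E_{X|Y}\bigr)=\mathfrak S_{Y|X}.$$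
   Context: $X,Y$ are defined on a probability space $(\Omega,\mathcal F,P)$ and take values in measurable spaces $(\Omega_X,\mathcal F_X)$, $(\Omega_Y,\mathcal F_Y)$, with distributions $P_X,P_Y,P_{XY}$ dominated by $\sigma$-finite measures; $P_{X|Y}(\cdot|y)$ is the (regular) conditional distribution of $X$ given $Y=y$; $\sigma(X)=X^{-1}(\mathcal F_X)$. $L_2(P_X)$, $L_2(P_Y)$ denote spaces of mean-zero square-integrable real functions. Density modulo constants: $A\subseteq B$ modulo constants if for each $f\in A$ there is $c\in\mathbb R$ with $f+c\in B$; $A$ is a dense subset of $B$ modulo constants if $A\subseteq B$ modulo constants and for each $f\in B$ there are $f_n\in A$ and $c_n\in\mathbb R$ with $f_n+c_n\in B$ and $f_n+c_n\to f$ in the topology of $B$. Operators: under (B), $M_{XX}\in\mathcal B(\mathcal H_X)$ is defined by $\langle f,M_{XX}g\rangle_{\mathcal H_X}=\operatorname{cov}[f(X),g(X)]$ and $M_{YY}\in\mathcal B(\mathcal H_Y)$ analogously. $\mathcal G_X=\overline{\operatorname{ran}}\,M_{XX}$, $\mathcal G_Y=\overline{\operatorname{ran}}\,M_{YY}$, with inner products inherited from $\mathcal H_X,\mathcal H_Y$. The covariance operators $\Sigma_{XX}:\mathcal G_X\to\mathcal G_X$, $\Sigma_{YY}:\mathcal G_Y\to\mathcal G_Y$, $\Sigma_{YX}:\mathcal G_X\to\mathcal G_Y$ are defined by $\langle f,\Sigma_{XX}g\rangle_{\mathcal G_X}=\operatorname{cov}[f(X),g(X)]$, $\langle f,\Sigma_{YY}g\rangle_{\mathcal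 G_Y}=\operatorname{cov}[f(Y),g(Y)]$, $\langle f,\Sigma_{YX}g\rangle_{\mathcal G_Y}=\operatorname{cov}[f(Y),g(X)]$. $R_{YX}\in\mathcal B(\mathcal G_X,\mathcal G_Y)$ is the unique bounded operator with $\Sigma_{YX}=\Sigma_{YY}^{1/2}R_{YX}\Sigma_{XX}^{1/2}$. $\tilde\Sigma_{XX}^{1/2}:L_2(P_X)\to\mathcal G_X$ and $\tilde\Sigma_{YY}^{1/2}:L_2(P_Y)\to\mathcal G_Y$ are the unique isomorphisms of Hilbert spaces (surjective linear isometries) with $\tilde\Sigma_{XX}^{1/2}(f-Ef(X))=\Sigma_{XX}^{1/2}f$ for $f\in\mathcal G_X$ and $\tilde\Sigma_{YY}^{1/2}(g-Eg(Y))=\Sigma_{YY}^{1/2}g$ for $g\in\mathcal G_Y$. The conditional expectation operator is $E_{X|Y}=\tilde\Sigma_{YY}^{-1/2}R_{YX}\tilde\Sigma_{XX}^{1/2}$, where $\tilde\Sigma_{YY}^{-1/2}$ is the inverse of $\tilde\Sigma_{YY}^{1/2}$; $E_{X|Y}^*$ is its adjoint. $\overline{\operatorname{ran}}$ denotes the closure of the range. Central class: the central $\sigma$-field $\mathcal G_{Y|X}$ is the smallest (modulo $P$-null sets) sub $\sigma$-field $\mathcal G$ of $\sigma(X)$ such that $Y$ and $X$ are conditionally independent given $\mathcal G$; it exists and is unique modulo null sets under the domination assumption. $\mathfrak S_{Y|X}$ is the set of all $f\in L_2(P_X)$ such that $f(X)$ is $\mathcal G_{Y|X}$-measurable (up to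 a.s. equality). It is complete if for every $g\in\mathfrak S_{Y|X}$, $E[g(X)|Y]=0$ a.s. implies $g(X)=0$ a.s. *)

theory Defs
  imports "HOL-Probability.Probability"
begin

section \<open>Mean-zero square-integrable functions\<close>

text \<open>
  Elements of \<open>L\<^sub>2(P)\<close> are represented by functions rather than by classes of functions modulo
  \<open>P\<close>-null sets. All subsets of \<open>L\<^sub>2(P)\<close> that are compared below (\<open>L2_closure P A\<close> and
  \<open>central_class\<close>) are closed under almost sure equality, so that equality of
  such sets of functions is the same as equality of the sets of classes.
\<close>

definition L2 :: "'x measure \<Rightarrow> ('x \<Rightarrow> real) set" where
  "L2 P = {f \<in> borel_measurable P. integrable P (\<lambda>x. (f x)\<^sup>2) \<and> (\<integral>x. f x \<partial>P) = 0}"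

definition L2_inner :: "'x measure \<Rightarrow> ('x \<Rightarrow> real) \<Rightarrow> ('x \<Rightarrow> real) \<Rightarrow> real" where
  "L2_inner P f g = (\<integral>x. f x * g x \<partial>P)"

definition L2_norm :: "'x measure \<Rightarrow> ('x \<Rightarrow> real) \<Rightarrow> real" where
  "L2_norm P f = sqrt (L2_inner P f f)"

definition L2_closure :: "'x measure \<Rightarrow> ('x \<Rightarrow> real) set \<Rightarrow> ('x \<Rightarrow> real) set" where
  "L2_closure P A = {f \<in> L2 P. \<forall>e>0. \<exists>g\<in>A. L2_norm P (\<lambda>x. f x - g x) < e}"

definition L2_adjoint ::
    "'x measure \<Rightarrow> 'y measure \<Rightarrow> (('x \<Rightarrow> real) \<Rightarrow> ('y \<Rightarrow> real)) \<Rightarrow> ('y \<Rightarrow> real) \<Rightarrow> ('x \<Rightarrow> real)" where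
  "L2_adjoint P Q E = (SOME B. B \<in> L2 Q \<rightarrow> L2 P \<and>
     (\<forall>f\<in>L2 P. \<forall>g\<in>L2 Q. L2_inner Q (E f) g = L2_inner P f (B g)))"


section \<open>Density modulo constants\<close>

definition subset_mod_const :: "('x \<Rightarrow> real) set \<Rightarrow> ('x \<Rightarrow> real) set \<Rightarrow> bool" where
  "subset_mod_const A B \<longleftrightarrow> (\<forall>f\<in>A. \<exists>c. (\<lambda>x. f x + c) \<in> B)"

definition dense_L2_mod_const :: "('x \<Rightarrow> real) set \<Rightarrow> 'x measure \<Rightarrow> bool" where
  "dense_L2_mod_const A P \<longleftrightarrow> subset_mod_const A (L2 P) \<and>
     (\<forall>f\<in>L2 P. \<exists>F c. (\<forall>n::nat. F n \<in> A \<and> (\<lambda>x. F n x + c n) \<in> L2 P) \<and>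
        (\<lambda>n. L2_norm P (\<lambda>x. (F n x + c n) - f x)) \<longlonglongrightarrow> 0)"


section \<open>Hilbert spaces of functions and operators on their subspaces\<close>

text \<open>
  A Hilbert space of real functions on \<open>S\<close> is given by a type \<open>'h\<close> of classes \<open>real_inner\<close> and
  \<open>complete_space\<close> whose elements are functions via \<open>evl :: 'h \<Rightarrow> 'x \<Rightarrow> real\<close>: the operations of
  \<open>'h\<close> are the pointwise ones on \<open>S\<close>, and elements that agree on \<open>S\<close> are equal.
\<close>

definition function_space_on :: "'x set \<Rightarrow> ('h::real_vector \<Rightarrow> 'x \<Rightarrow> real) \<Rightarrow> bool" where
  "function_space_on S evl \<longleftrightarrow>
     (\<forall>x\<in>S. linear (\<lambda>f. evl f x)) \<and> (\<forall>f g. (\<forall>x\<in>S. evl f x = evl g x) \<longrightarrow> f = g)"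

definition bounded_op_on ::
    "'a::real_normed_vector set \<Rightarrow> 'b::real_normed_vector set \<Rightarrow> ('a \<Rightarrow> 'b) \<Rightarrow> bool" where
  "bounded_op_on A B T \<longleftrightarrow> T \<in> A \<rightarrow> B \<and>
     (\<forall>f\<in>A. \<forall>g\<in>A. T (f + g) = T f + T g) \<and>
     (\<forall>c. \<forall>f\<in>A. T (c *\<^sub>R f) = c *\<^sub>R T f) \<and>
     (\<exists>K. \<forall>f\<in>A. norm (T f) \<le> K * norm f)"

text \<open>
  The operators below are determined on the given subspaces only; their values elsewhere are
  arbitrary and never used.
\<close>

definition pos_sqrt_on :: "'h::real_inner set \<Rightarrow> ('h \<Rightarrow> 'h) \<Rightarrow> 'h \<Rightarrow> 'h" where
  "pos_sqrt_on A S = (SOME T. bounded_op_on A A T \<and>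
     (\<forall>f\<in>A. \<forall>g\<in>A. inner f (T g) = inner (T f) g) \<and>
     (\<forall>f\<in>A. inner f (T f) \<ge> 0) \<and>
     (\<forall>f\<in>A. T (T f) = S f))"


section \<open>Covariance operators\<close>

definition covariance :: "'w measure \<Rightarrow> ('w \<Rightarrow> real) \<Rightarrow> ('w \<Rightarrow> real) \<Rightarrow> real" where
  "covariance M U V = (\<integral>w. (U w - (\<integral>z. U z \<partial>M)) * (V w - (\<integral>z. V z \<partial>M)) \<partial>M)"

text \<open>
  \<open>cov_op M X evX A Y evY B\<close> is the bounded operator \<open>T : A \<rightarrow> B\<close> with
  \<open>\<langle>f, T g\<rangle> = cov[f(Y), g(X)]\<close> for \<open>g \<in> A\<close>, \<open>f \<in> B\<close>.
\<close>

definition cov_op ::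
    "'w measure \<Rightarrow> ('w \<Rightarrow> 'x) \<Rightarrow> ('h \<Rightarrow> 'x \<Rightarrow> real) \<Rightarrow> 'h::real_inner set \<Rightarrow>
     ('w \<Rightarrow> 'y) \<Rightarrow> ('k \<Rightarrow> 'y \<Rightarrow> real) \<Rightarrow> 'k::real_inner set \<Rightarrow> 'h \<Rightarrow> 'k" where
  "cov_op M X evX A Y evY B = (SOME T. bounded_op_on A B T \<and>
     (\<forall>g\<in>A. \<forall>f\<in>B. inner f (T g) = covariance M (\<lambda>w. evY f (Y w)) (\<lambda>w. evX g (X w))))"

definition M_op :: "'w measure \<Rightarrow> ('w \<Rightarrow> 'x) \<Rightarrow> ('h::real_inner \<Rightarrow> 'x \<Rightarrow> real) \<Rightarrow> 'h \<Rightarrow> 'h" where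
  "M_op M X evl = cov_op M X evl UNIV X evl UNIV"

definition G_space :: "'w measure \<Rightarrow> ('w \<Rightarrow> 'x) \<Rightarrow> ('h::real_inner \<Rightarrow> 'x \<Rightarrow> real) \<Rightarrow> 'h set" where
  "G_space M X evl = closure (range (M_op M X evl))"

definition Sigma_op ::
    "'w measure \<Rightarrow> ('w \<Rightarrow> 'x) \<Rightarrow> ('h::real_inner \<Rightarrow> 'x \<Rightarrow> real) \<Rightarrow>
     ('w \<Rightarrow> 'y) \<Rightarrow> ('k::real_inner \<Rightarrow> 'y \<Rightarrow> real) \<Rightarrow> 'h \<Rightarrow> 'k" where
  "Sigma_op M X evX Y evY = cov_op M X evX (G_space M X evX) Y evY (G_space M Y evY)"

definition Sigma_sqrt ::
    "'w measure \<Rightarrow> ('w \<Rightarrow> 'x) \<Rightarrow> ('h::real_inner \<Rightarrow> 'x \<Rightarrow> real) \<Rightarrow> 'h \<Rightarrow> 'h" where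
  "Sigma_sqrt M X evl = pos_sqrt_on (G_space M X evl) (Sigma_op M X evl X evl)"

definition R_op ::
    "'w measure \<Rightarrow> ('w \<Rightarrow> 'x) \<Rightarrow> ('h::real_inner \<Rightarrow> 'x \<Rightarrow> real) \<Rightarrow>
     ('w \<Rightarrow> 'y) \<Rightarrow> ('k::real_inner \<Rightarrow> 'y \<Rightarrow> real) \<Rightarrow> 'h \<Rightarrow> 'k" where
  "R_op M X evX Y evY = (SOME R. bounded_op_on (G_space M X evX) (G_space M Y evY) R \<and>
     (\<forall>f\<in>G_space M X evX.
        Sigma_op M X evX Y evY f = Sigma_sqrt M Y evY (R (Sigma_sqrt M X evX f))))"


section \<open>The conditional expectation operator\<close>

text \<open>The extension of \<open>Sigma_sqrt\<close> to a surjective linear isometry from \<open>L2\<close> of the distribution of \<open>X\<close> onto \<open>G_space\<close>.\<close>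

definition Sigma_sqrt_ext ::
    "'w measure \<Rightarrow> 'x measure \<Rightarrow> ('w \<Rightarrow> 'x) \<Rightarrow> ('h::real_inner \<Rightarrow> 'x \<Rightarrow> real) \<Rightarrow>
     ('x \<Rightarrow> real) \<Rightarrow> 'h" where
  "Sigma_sqrt_ext M MX X evl = (SOME T.
     (\<forall>f\<in>L2 (distr M MX X). \<forall>g\<in>L2 (distr M MX X). T (\<lambda>x. f x + g x) = T f + T g) \<and>
     (\<forall>c. \<forall>f\<in>L2 (distr M MX X). T (\<lambda>x. c * f x) = c *\<^sub>R T f) \<and>
     (\<forall>f\<in>L2 (distr M MX X). norm (T f) = L2_norm (distr M MX X) f) \<and>
     T ` L2 (distr M MX X) = G_space M X evl \<and>
     (\<forall>f\<in>G_space M X evl. T (\<lambda>x. evl f x - (\<integral>w. evl f (X w) \<partial>M)) = Sigma_sqrt M X evl f))"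

text \<open>
  The inverse of \<open>Sigma_sqrt_ext\<close> on \<open>L2\<close> selects a representative, so \<open>cond_exp_op\<close> is determined
  up to almost sure equality.
\<close>

definition cond_exp_op ::
    "'w measure \<Rightarrow> 'x measure \<Rightarrow> ('w \<Rightarrow> 'x) \<Rightarrow> ('h::real_inner \<Rightarrow> 'x \<Rightarrow> real) \<Rightarrow>
     'y measure \<Rightarrow> ('w \<Rightarrow> 'y) \<Rightarrow> ('k::real_inner \<Rightarrow> 'y \<Rightarrow> real) \<Rightarrow> ('x \<Rightarrow> real) \<Rightarrow> ('y \<Rightarrow> real)" where
  "cond_exp_op M MX X evX MY Y evY f =
     inv_into (L2 (distr M MY Y)) (Sigma_sqrt_ext M MY Y evY)
       (R_op M X evX Y evY (Sigma_sqrt_ext M MX X evX f))"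


section \<open>The central sigma-field and the central class\<close>

definition regular_cond_distr ::
    "'w measure \<Rightarrow> 'x measure \<Rightarrow> ('w \<Rightarrow> 'x) \<Rightarrow> 'y measure \<Rightarrow> ('w \<Rightarrow> 'y) \<Rightarrow> ('y \<Rightarrow> 'x measure) \<Rightarrow> bool"
  where
  "regular_cond_distr M MX X MY Y K \<longleftrightarrow> K \<in> measurable MY (prob_algebra MX) \<and>
     (\<forall>A\<in>sets MX. \<forall>B\<in>sets MY.
        emeasure M (X -` A \<inter> Y -` B \<inter> space M) = (\<integral>\<^sup>+y\<in>B. emeasure (K y) A \<partial>distr M MY Y))"

definition dominated_family :: "'x measure \<Rightarrow> 'x measure set \<Rightarrow> bool" where
  "dominated_family MX \<P> \<longleftrightarrow>
     (\<exists>\<mu>. sigma_finite_measure \<mu> \<and> sets \<mu> = sets MX \<and> (\<forall>P\<in>\<P>. absolutely_continuous \<mu> P))"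

definition sigma_field_of :: "'w measure \<Rightarrow> 'x measure \<Rightarrow> ('w \<Rightarrow> 'x) \<Rightarrow> 'w measure" where
  "sigma_field_of M MX X = vimage_algebra (space M) X MX"

text \<open>Sub sigma-fields of \<open>M\<close> are measures \<open>G\<close> of which only \<open>space G\<close> and \<open>sets G\<close> matter.\<close>

definition cond_indep ::
    "'w measure \<Rightarrow> 'x measure \<Rightarrow> ('w \<Rightarrow> 'x) \<Rightarrow> 'y measure \<Rightarrow> ('w \<Rightarrow> 'y) \<Rightarrow> 'w measure \<Rightarrow> bool" where
  "cond_indep M MX X MY Y G \<longleftrightarrow>
     (\<forall>A\<in>sets MX. \<forall>B\<in>sets MY. AE w in M.
        real_cond_exp M G (\<lambda>z. indicator A (X z) * indicator B (Y z)) w =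
        real_cond_exp M G (\<lambda>z. indicator A (X z)) w * real_cond_exp M G (\<lambda>z. indicator B (Y z)) w)"

definition sub_mod_null :: "'w measure \<Rightarrow> 'w measure \<Rightarrow> 'w measure \<Rightarrow> bool" where
  "sub_mod_null M G G' \<longleftrightarrow> (\<forall>A\<in>sets G. \<exists>B\<in>sets G'. AE w in M. w \<in> A \<longleftrightarrow> w \<in> B)"

definition central_sigma_field ::
    "'w measure \<Rightarrow> 'x measure \<Rightarrow> ('w \<Rightarrow> 'x) \<Rightarrow> 'y measure \<Rightarrow> ('w \<Rightarrow> 'y) \<Rightarrow> 'w measure \<Rightarrow> bool" where
  "central_sigma_field M MX X MY Y G \<longleftrightarrow>
     subalgebra (sigma_field_of M MX X) G \<and> cond_indep M MX X MY Y G \<and>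
     (\<forall>G'. subalgebra (sigma_field_of M MX X) G' \<and> cond_indep M MX X MY Y G' \<longrightarrow>
        sub_mod_null M G G')"

definition central_class ::
    "'w measure \<Rightarrow> 'x measure \<Rightarrow> ('w \<Rightarrow> 'x) \<Rightarrow> 'w measure \<Rightarrow> ('x \<Rightarrow> real) set" where
  "central_class M MX X G =
     {f \<in> L2 (distr M MX X). \<exists>h\<in>borel_measurable G. AE w in M. f (X w) = h w}"

definition complete_class ::
    "'w measure \<Rightarrow> ('w \<Rightarrow> 'x) \<Rightarrow> 'y measure \<Rightarrow> ('w \<Rightarrow> 'y) \<Rightarrow> ('x \<Rightarrow> real) set \<Rightarrow> bool" where
  "complete_class M X MY Y S \<longleftrightarrow>
     (\<forall>g\<in>S. (AE w in M. real_cond_exp M (sigma_field_of M MY Y) (\<lambda>z. g (X z)) w = 0) \<longrightarrow>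
        (AE w in M. g (X w) = 0))"

end

theory Submission
  imports Defs
begin

text \<open>
  Write \<open>P\<^sub>X\<close>, \<open>P\<^sub>Y\<close> for the distributions of \<open>X\<close> and \<open>Y\<close>, and \<open>E\<close> for the operator \<open>cond_exp_op\<close>,
  which is assembled from square roots of covariance operators. All that the
  theorem needs to know about \<open>E\<close> is the identity \<open>\<langle>g, E f\<rangle> = \<integral> g(Y) f(X)\<close> for mean-zero square-integrable
  \<open>f\<close> and \<open>g\<close>, that is, that \<open>E f\<close> is the conditional expectation of \<open>f(X)\<close> given \<open>Y\<close>
  (\<open>E_pairing\<close>); its adjoint is then the conditional expectation of \<open>g(Y)\<close> given \<open>X\<close>
  (\<open>E_adj_pairing\<close>).
  
  With these identities the theorem is a statement about conditional independence. Let \<open>F\<close> be the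
  central sigma-field. As \<open>X\<close> and \<open>Y\<close> are conditionally independent given \<open>F \<subseteq> \<sigma>(X)\<close>, the
  conditional expectations of \<open>g(Y)\<close> given \<open>X\<close> and given \<open>F\<close> coincide, so the adjoint takes values in
  the central class (\<open>E_adj_in_central_class\<close>), which is closed (\<open>central_class_closed\<close>); this gives
  one inclusion. For the other, split \<open>f\<close> in the central class as \<open>p + r\<close> with \<open>p\<close> in the closure of
  the range of \<open>E\<^sup>*E\<close> and \<open>r\<close> orthogonal to that range (\<open>closure_range_residual\<close>). Then \<open>r\<close> lies in the
  central class and \<open>\<parallel>E r\<parallel>\<^sup>2 = \<langle>r, E\<^sup>*E r\<rangle> = 0\<close>, so the conditional expectation of \<open>r(X)\<close> given \<open>Y\<close>
  vanishes, and completeness yields \<open>r = 0\<close>.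
  
  Most of the work is to show that the operators in the definition of \<open>E\<close> exist, since each of them is
  chosen by its defining property. Operators given by a bounded bilinear form come from the Riesz
  representation theorem (\<open>bounded_form_operator\<close>), and the square root \<open>S\<close> of the covariance operator
  from a fixed-point iteration (\<open>positive_sqrt_exists\<close>). Let \<open>J h\<close> be the centred function
  of \<open>h\<close> and \<open>G\<close> the closed range of the operator \<open>M\<^sub>X\<^sub>X\<close>. Then \<open>\<parallel>S h\<parallel> = \<parallel>J h\<parallel>\<close> for \<open>h \<in> G\<close>, and
  \<open>J ` G\<close> and \<open>S ` G\<close> are dense in \<open>L\<^sub>2(P\<^sub>X)\<close> and \<open>G\<close>. As both spaces are complete (\<open>L2_complete\<close>), the
  map \<open>J h \<mapsto> S h\<close> extends to an isometry \<open>T\<close> of \<open>L\<^sub>2(P\<^sub>X)\<close> onto \<open>G\<close> (\<open>isometric_extension_exists\<close>). This isometry also serves to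
  transport orthogonal projections in \<open>L\<^sub>2(P\<^sub>X)\<close> to projections in the Hilbert space of functions.
\<close>

section \<open>Functionals, projections and forms on closed subspaces\<close>

text \<open>
  The representing element minimises \<open>\<parallel>f\<parallel>\<^sup>2 - 2 \<phi>(f)\<close> over \<open>S\<close>: by the parallelogram identity a minimising
  sequence is Cauchy, and at the minimum the derivative in each direction of \<open>S\<close> vanishes.
\<close>
lemma riesz_closed_subspace:
  fixes S :: "'a::{real_inner,complete_space} set" and phi :: "'a \<Rightarrow> real"
  assumes S: "subspace S" "closed S"
    and add: "\<And>f g. f \<in> S \<Longrightarrow> g \<in> S \<Longrightarrow> phi (f + g) = phi f + phi g"
    and scale: "\<And>c f. f \<in> S \<Longrightarrow> phi (c *\<^sub>R f) = c * phi f"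
    and bound: "\<And>f. f \<in> S \<Longrightarrow> \<bar>phi f\<bar> \<le> K * norm f"
  shows "\<exists>z\<in>S. \<forall>f\<in>S. inner f z = phi f"
proof -
  define F where "F f = (norm f)\<^sup>2 - 2 * phi f" for f
  have lower: "F f \<ge> - K\<^sup>2" if "f \<in> S" for f
  proof -
    have "0 \<le> (norm f - K)\<^sup>2" by simp
    then show ?thesis
      using bound[OF that] unfolding F_def by (simp add: power2_diff algebra_simps)
  qed
  have bdd: "bdd_below (F ` S)" using lower by (auto simp: bdd_below_def)
  define m where "m = Inf (F ` S)"
  have m_le: "m \<le> F f" if "f \<in> S" for f
    unfolding m_def by (rule cINF_lower[OF bdd that])
  have ne: "F ` S \<noteq> {}" using subspace_0[OF S(1)] by auto
  have "\<exists>z\<in>S. F z < m + inverse (real (Suc n))" for n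
  proof -
    have "Inf (F ` S) < m + inverse (real (Suc n))" unfolding m_def by simp
    from cInf_lessD[OF ne this] show ?thesis by auto
  qed
  then obtain z where zS: "z n \<in> S" and zF: "F (z n) < m + inverse (real (Suc n))" for n
    by metis
  have parallelogram: "(norm (f - g))\<^sup>2 = 2 * F f + 2 * F g - 4 * F ((1/2) *\<^sub>R (f + g))"
    if "f \<in> S" "g \<in> S" for f g
    using that scale[of "f + g" "1/2"] add[of f g] subspace_add[OF S(1)]
    unfolding F_def power2_norm_eq_inner
    by (simp add: inner_diff_left inner_diff_right inner_add_left inner_add_right inner_commute field_simps)
  have dist_z: "(norm (z i - z j))\<^sup>2 \<le> 4 * inverse (real (Suc n))" if "i \<ge> n" "j \<ge> n" for i j n
  proof -
    have "(1/2) *\<^sub>R (z i + z j) \<in> S" using S(1) zS by (simp add: subspace_add subspace_scale)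
    from m_le[OF this] have "(norm (z i - z j))\<^sup>2 \<le> 2 * inverse (real (Suc i)) + 2 * inverse (real (Suc j))"
      using parallelogram[OF zS[of i] zS[of j]] zF[of i] zF[of j] by linarith
    moreover have "inverse (real (Suc i)) \<le> inverse (real (Suc n))"
      "inverse (real (Suc j)) \<le> inverse (real (Suc n))"
      using that by (auto intro!: le_imp_inverse_le)
    ultimately show ?thesis by linarith
  qed
  have "Cauchy z"
  proof (rule metric_CauchyI)
    fix e :: real assume e: "e > 0"
    obtain n where n: "inverse (real (Suc n)) < e\<^sup>2 / 4"
      using reals_Archimedean[of "e\<^sup>2 / 4"] e by auto
    show "\<exists>N. \<forall>i\<ge>N. \<forall>j\<ge>N. dist (z i) (z j) < e"
    proof (intro exI[of _ n] allI impI)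
      fix i j assume "n \<le> i" "n \<le> j"
      then have "(norm (z i - z j))\<^sup>2 < e\<^sup>2" using dist_z[of n i j] n by linarith
      then show "dist (z i) (z j) < e"
        using e by (simp add: dist_norm power2_less_imp_less)
    qed
  qed
  then obtain l where l: "z \<longlonglongrightarrow> l" using Cauchy_convergent convergent_def by blast
  have lS: "l \<in> S" using closed_sequentially[OF S(2)] zS l by blast
  have phi_diff: "phi f - phi g = phi (f - g)" if "f \<in> S" "g \<in> S" for f g
    using add[of "f - g" g] that subspace_diff[OF S(1)] by simp
  have "(\<lambda>n. phi (z n) - phi l) \<longlonglongrightarrow> 0"
  proof (rule Lim_null_comparison)
    show "\<forall>\<^sub>F n in sequentially. norm (phi (z n) - phi l) \<le> K * norm (z n - l)"
      using phi_diff bound zS lS S(1) by (auto simp: subspace_diff)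
    have "(\<lambda>n. K * norm (z n - l)) \<longlonglongrightarrow> K * norm (l - l)"
      using l by (intro tendsto_intros)
    then show "(\<lambda>n. K * norm (z n - l)) \<longlonglongrightarrow> 0" by simp
  qed
  then have "(\<lambda>n. phi (z n)) \<longlonglongrightarrow> phi l" by (rule LIM_zero_cancel)
  then have "(\<lambda>n. F (z n)) \<longlonglongrightarrow> F l"
    unfolding F_def using l by (intro tendsto_intros)
  moreover have "(\<lambda>n. m + inverse (real (Suc n))) \<longlonglongrightarrow> m + 0"
    by (intro tendsto_intros LIMSEQ_inverse_real_of_nat)
  ultimately have Fl: "F l \<le> m"
    using LIMSEQ_le[of "\<lambda>n. F (z n)" "F l" "\<lambda>n. m + inverse (real (Suc n))" m] zF by (auto intro: less_imp_le)
  have "inner f l = phi f" if f: "f \<in> S" for f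
  proof (cases "f = 0")
    case True
    then show ?thesis using scale[OF f, of 0] by simp
  next
    case False
    define d where "d = inner f l - phi f"
    \<comment> \<open>the minimiser of the quadratic polynomial \<open>t \<mapsto> F (l + t f)\<close>\<close>
    define t where "t = - d / (norm f)\<^sup>2"
    have tf: "t *\<^sub>R f \<in> S" using S(1) f by (simp add: subspace_scale)
    have "m \<le> F (l + t *\<^sub>R f)" using m_le lS tf S(1) by (simp add: subspace_add)
    then have "0 \<le> F (l + t *\<^sub>R f) - F l" using Fl by simp
    also have "F (l + t *\<^sub>R f) - F l = 2 * t * d + t\<^sup>2 * (norm f)\<^sup>2"
      unfolding F_def d_def power2_norm_eq_inner
      using add[OF lS tf] scale[OF f, of t]
      by (simp add: inner_add_left inner_add_right inner_commute algebra_simps power2_eq_square)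
    also have "\<dots> = - (d\<^sup>2 / (norm f)\<^sup>2)"
      unfolding t_def using False by (simp add: field_simps power2_eq_square)
    finally have "d\<^sup>2 / (norm f)\<^sup>2 \<le> 0" by simp
    then have "d = 0" using False by (simp add: divide_le_0_iff)
    then show ?thesis by (simp add: d_def)
  qed
  then show ?thesis using lS by blast
qed

text \<open>
  The projection of \<open>x\<close> represents the functional \<open>f \<mapsto> \<langle>f, x\<rangle>\<close> on \<open>S\<close>.
\<close>
lemma orthogonal_projection_exists:
  fixes S :: "'a::{real_inner,complete_space} set"
  assumes "subspace S" "closed S"
  shows "\<exists>p\<in>S. \<forall>f\<in>S. inner f (x - p) = 0"
proof -
  have "\<exists>p\<in>S. \<forall>f\<in>S. inner f p = inner f x"
    by (rule riesz_closed_subspace[OF assms, where K = "norm x"])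
       (auto simp: inner_add_left Cauchy_Schwarz_ineq2 mult.commute)
  then show ?thesis by (metis inner_diff_right right_minus_eq)
qed

lemma subspace_eqI:
  fixes u v :: "'a::real_inner"
  assumes "subspace S" "u \<in> S" "v \<in> S" "\<And>f. f \<in> S \<Longrightarrow> inner f u = inner f v"
  shows "u = v"
proof -
  have "inner (u - v) (u - v) = 0"
    using assms(4)[OF subspace_diff[OF assms(1-3)]] by (simp add: inner_diff_right)
  then show ?thesis by simp
qed

text \<open>
  This is the common source of the covariance operators, of the correlation operator \<open>R\<close> and of the
  adjoint of the conditional expectation operator: each is defined by prescribing \<open>\<langle>f, T g\<rangle>\<close>.
\<close>
lemma bounded_form_operator:
  fixes A :: "'a::real_normed_vector set" and B :: "'b::{real_inner,complete_space} set"
  assumes A: "subspace A" and B: "subspace B" "closed B"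
    and add_left: "\<And>f f' g. f \<in> B \<Longrightarrow> f' \<in> B \<Longrightarrow> g \<in> A \<Longrightarrow> b (f + f') g = b f g + b f' g"
    and scale_left: "\<And>c f g. f \<in> B \<Longrightarrow> g \<in> A \<Longrightarrow> b (c *\<^sub>R f) g = c * b f g"
    and add_right: "\<And>f g g'. f \<in> B \<Longrightarrow> g \<in> A \<Longrightarrow> g' \<in> A \<Longrightarrow> b f (g + g') = b f g + b f g'"
    and scale_right: "\<And>c f g. f \<in> B \<Longrightarrow> g \<in> A \<Longrightarrow> b f (c *\<^sub>R g) = c * b f g"
    and bound: "\<And>f g. f \<in> B \<Longrightarrow> g \<in> A \<Longrightarrow> \<bar>b f g\<bar> \<le> K * norm f * norm g"
  shows "\<exists>T. bounded_op_on A B T \<and> (\<forall>g\<in>A. \<forall>f\<in>B. inner f (T g) = b f g)"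
proof -
  have "\<exists>z\<in>B. \<forall>f\<in>B. inner f z = b f g" if g: "g \<in> A" for g
    by (rule riesz_closed_subspace[OF B, where K = "K * norm g"])
       (use add_left scale_left bound g in \<open>auto simp: algebra_simps\<close>)
  then obtain T where TB: "\<And>g. g \<in> A \<Longrightarrow> T g \<in> B"
    and T: "\<And>f g. g \<in> A \<Longrightarrow> f \<in> B \<Longrightarrow> inner f (T g) = b f g"
    by metis
  have "T (g + h) = T g + T h" if "g \<in> A" "h \<in> A" for g h
    by (rule subspace_eqI[OF B(1)])
       (use that A B in \<open>auto simp: TB T add_right subspace_add inner_add_right\<close>)
  moreover have "T (c *\<^sub>R g) = c *\<^sub>R T g" if "g \<in> A" for c g
    by (rule subspace_eqI[OF B(1)])
       (use that A B in \<open>auto simp: TB T scale_right subspace_scale\<close>)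
  moreover have "norm (T g) \<le> \<bar>K\<bar> * norm g" if g: "g \<in> A" for g
  proof (cases "T g = 0")
    case False
    have "norm (T g) * norm (T g) = b (T g) g"
      using T[OF g TB[OF g]] by (simp add: power2_norm_eq_inner flip: power2_eq_square)
    also have "\<dots> \<le> K * norm (T g) * norm g"
      using bound[OF TB[OF g] g] by simp
    also have "\<dots> \<le> \<bar>K\<bar> * norm (T g) * norm g"
      by (intro mult_right_mono) auto
    finally have "norm (T g) * norm (T g) \<le> (\<bar>K\<bar> * norm g) * norm (T g)"
      by (simp add: algebra_simps)
    then show ?thesis using False by simp
  qed simp
  ultimately show ?thesis
    unfolding bounded_op_on_def using TB T by (intro exI[of _ T] conjI) (auto intro: exI[of _ "\<bar>K\<bar>"])
qed

lemma subspace_closure_of_subspace: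
  fixes S :: "'a::real_normed_vector set"
  assumes "subspace S"
  shows "subspace (closure S)"
  unfolding subspace_def
proof (intro conjI ballI allI)
  show "0 \<in> closure S" using subspace_0[OF assms] closure_subset by blast
next
  fix x y assume "x \<in> closure S" "y \<in> closure S"
  then obtain u v where "\<And>n. u n \<in> S" "u \<longlonglongrightarrow> x" "\<And>n. v n \<in> S" "v \<longlonglongrightarrow> y"
    unfolding closure_sequential by blast
  then show "x + y \<in> closure S"
    unfolding closure_sequential using subspace_add[OF assms]
    by (intro exI[of _ "\<lambda>n. u n + v n"]) (auto intro: tendsto_add)
next
  fix c x assume "x \<in> closure S"
  then obtain u where "\<And>n. u n \<in> S" "u \<longlonglongrightarrow> x"
    unfolding closure_sequential by blast
  then show "c *\<^sub>R x \<in> closure S"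
    unfolding closure_sequential using subspace_scale[OF assms]
    by (intro exI[of _ "\<lambda>n. c *\<^sub>R u n"]) (auto intro: tendsto_scaleR)
qed

lemma bounded_op_on_image_subspace:
  assumes T: "bounded_op_on A B T" and A: "subspace A"
  shows "subspace (T ` A)"
  unfolding subspace_def
proof (intro conjI ballI allI)
  have "T (0 *\<^sub>R 0) = 0 *\<^sub>R T 0"
    using T subspace_0[OF A] unfolding bounded_op_on_def by blast
  then have "T 0 = 0" by simp
  then show "0 \<in> T ` A" using subspace_0[OF A] by force
next
  fix x y assume "x \<in> T ` A" "y \<in> T ` A"
  then obtain a b where ab: "a \<in> A" "b \<in> A" "x = T a" "y = T b" by blast
  then have "x + y = T (a + b)" using T unfolding bounded_op_on_def by auto
  then show "x + y \<in> T ` A" using subspace_add[OF A ab(1,2)] by blast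
next
  fix c x assume "x \<in> T ` A"
  then obtain a where a: "a \<in> A" "x = T a" by blast
  then have "c *\<^sub>R x = T (c *\<^sub>R a)" using T unfolding bounded_op_on_def by auto
  then show "c *\<^sub>R x \<in> T ` A" using subspace_scale[OF A a(1)] by blast
qed

lemma bounded_op_on_mem: "bounded_op_on A B T \<Longrightarrow> f \<in> A \<Longrightarrow> T f \<in> B"
  and bounded_op_on_add: "bounded_op_on A B T \<Longrightarrow> f \<in> A \<Longrightarrow> g \<in> A \<Longrightarrow> T (f + g) = T f + T g"
  and bounded_op_on_scale: "bounded_op_on A B T \<Longrightarrow> f \<in> A \<Longrightarrow> T (c *\<^sub>R f) = c *\<^sub>R T f"
  unfolding bounded_op_on_def by auto

lemma bounded_op_on_bound:
  assumes "bounded_op_on A B T"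
  obtains K where "\<And>f. f \<in> A \<Longrightarrow> norm (T f) \<le> K * norm f"
  using assms unfolding bounded_op_on_def by blast

section \<open>Square roots of positive operators\<close>

text \<open>
  If \<open>2 Q = B + Q\<^sup>2\<close> then \<open>(I - Q)\<^sup>2 = I - B\<close>, so a fixed point of this iteration yields a square root of
  \<open>I - B\<close>.
\<close>
primrec sqrt_iter :: "('a::real_vector \<Rightarrow> 'a) \<Rightarrow> nat \<Rightarrow> 'a \<Rightarrow> 'a" where
  "sqrt_iter B 0 f = 0"
| "sqrt_iter B (Suc n) f = (1/2) *\<^sub>R (B f + sqrt_iter B n (sqrt_iter B n f))"

text \<open>
  The same iteration for the number \<open>B = 1\<close>. For a contraction \<open>B\<close> its increments bound those of the
  operator iteration.
\<close>
primrec sqrt_majorant :: "nat \<Rightarrow> real" where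
  "sqrt_majorant 0 = 0"
| "sqrt_majorant (Suc n) = (1 + (sqrt_majorant n)\<^sup>2) / 2"

lemma sqrt_majorant_bounds: "0 \<le> sqrt_majorant n \<and> sqrt_majorant n \<le> 1"
  by (induction n) (auto simp: power_le_one)

lemma sqrt_majorant_Suc_ge: "sqrt_majorant n \<le> sqrt_majorant (Suc n)"
proof -
  have "0 \<le> (1 - sqrt_majorant n)\<^sup>2" by simp
  then show ?thesis by (simp add: power2_diff)
qed

lemma sqrt_majorant_Cauchy: "Cauchy sqrt_majorant"
proof -
  have "incseq sqrt_majorant" using sqrt_majorant_Suc_ge by (rule incseq_SucI)
  then have "convergent sqrt_majorant"
    using sqrt_majorant_bounds incseq_convergent[of sqrt_majorant 1] by (metis convergent_def)
  then show ?thesis by (rule convergent_Cauchy)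
qed

text \<open>
  The iterates \<open>Y\<^sub>n\<close> converge in operator norm because
  \<open>Y\<^sub>n\<^sub>+\<^sub>1\<^sup>2 - Y\<^sub>n\<^sup>2 = Y\<^sub>n\<^sub>+\<^sub>1 (Y\<^sub>n\<^sub>+\<^sub>1 - Y\<^sub>n) + (Y\<^sub>n\<^sub>+\<^sub>1 - Y\<^sub>n) Y\<^sub>n\<close>
  lets the increments be estimated by those of the scalar majorant, which is increasing and bounded by 1. Linearity,
  symmetry and the norm bound pass to the limit.
\<close>
lemma contraction_fixpoint_square:
  fixes A :: "'a::{real_inner,complete_space} set" and B :: "'a \<Rightarrow> 'a"
  assumes A: "subspace A" "closed A"
    and BA: "\<And>f. f \<in> A \<Longrightarrow> B f \<in> A"
    and add: "\<And>f g. f \<in> A \<Longrightarrow> g \<in> A \<Longrightarrow> B (f + g) = B f + B g"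
    and scale: "\<And>c f. f \<in> A \<Longrightarrow> B (c *\<^sub>R f) = c *\<^sub>R B f"
    and contr: "\<And>f. f \<in> A \<Longrightarrow> norm (B f) \<le> norm f"
    and sym: "\<And>f g. f \<in> A \<Longrightarrow> g \<in> A \<Longrightarrow> inner f (B g) = inner (B f) g"
  obtains Q where "\<And>f. f \<in> A \<Longrightarrow> Q f \<in> A"
    and "\<And>f g. f \<in> A \<Longrightarrow> g \<in> A \<Longrightarrow> Q (f + g) = Q f + Q g"
    and "\<And>c f. f \<in> A \<Longrightarrow> Q (c *\<^sub>R f) = c *\<^sub>R Q f"
    and "\<And>f. f \<in> A \<Longrightarrow> norm (Q f) \<le> norm f"
    and "\<And>f g. f \<in> A \<Longrightarrow> g \<in> A \<Longrightarrow> inner f (Q g) = inner (Q f) g"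
    and "\<And>f. f \<in> A \<Longrightarrow> 2 *\<^sub>R Q f = B f + Q (Q f)"
proof -
  let ?Y = "sqrt_iter B" and ?a = sqrt_majorant
  have YA: "?Y n f \<in> A" if "f \<in> A" for n f
    using that by (induction n arbitrary: f) (use A in \<open>auto simp: BA subspace_add subspace_scale subspace_0\<close>)
  have Yadd: "?Y n (f + g) = ?Y n f + ?Y n g" if "f \<in> A" "g \<in> A" for n f g
    using that by (induction n arbitrary: f g) (auto simp: add YA algebra_simps)
  have Yscale: "?Y n (c *\<^sub>R f) = c *\<^sub>R ?Y n f" if "f \<in> A" for n c f
    using that by (induction n arbitrary: f) (auto simp: scale YA algebra_simps)
  have Ydiff: "?Y n (f - g) = ?Y n f - ?Y n g" if "f \<in> A" "g \<in> A" for n f g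
    using Yadd[of "f - g" g n] that A by (simp add: subspace_diff)
  have Ysym: "inner f (?Y n g) = inner (?Y n f) g" if "f \<in> A" "g \<in> A" for n f g
    using that by (induction n arbitrary: f g) (auto simp: sym YA inner_add_left inner_add_right)
  have Ynorm: "norm (?Y n f) \<le> ?a n * norm f" if "f \<in> A" for n f
    using that
  proof (induction n arbitrary: f)
    case (Suc n)
    have "norm (?Y n (?Y n f)) \<le> ?a n * norm (?Y n f)" by (rule Suc.IH[OF YA[OF Suc.prems]])
    also have "\<dots> \<le> ?a n * (?a n * norm f)"
      using Suc.IH[OF Suc.prems] sqrt_majorant_bounds[of n] by (intro mult_left_mono) auto
    finally have "norm (?Y n (?Y n f)) \<le> (?a n)\<^sup>2 * norm f" by (simp add: power2_eq_square)
    then have "norm (B f + ?Y n (?Y n f)) \<le> (1 + (?a n)\<^sup>2) * norm f"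
      using norm_triangle_ineq[of "B f" "?Y n (?Y n f)"] contr[OF Suc.prems] by (simp add: algebra_simps)
    then show ?case by simp
  qed simp
  have step: "norm (?Y (Suc n) f - ?Y n f) \<le> (?a (Suc n) - ?a n) * norm f" if "f \<in> A" for n f
    using that
  proof (induction n arbitrary: f)
    case 0
    then show ?case using contr[of f] by simp
  next
    case (Suc n)
    let ?u = "?Y (Suc n) f" and ?v = "?Y n f" and ?d = "?a (Suc n) - ?a n"
    have d0: "0 \<le> ?d" using sqrt_majorant_Suc_ge[of n] by simp
    have u: "?u \<in> A" and v: "?v \<in> A" using YA Suc.prems by blast+
    have "?Y (Suc (Suc n)) f = (1/2) *\<^sub>R (B f + ?Y (Suc n) ?u)"
      and "?u = (1/2) *\<^sub>R (B f + ?Y n ?v)" by (rule sqrt_iter.simps(2))+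
    then have "?Y (Suc (Suc n)) f - ?u
        = (1/2) *\<^sub>R (B f + ?Y (Suc n) ?u) - (1/2) *\<^sub>R (B f + ?Y n ?v)"
      by (rule arg_cong2)
    also have "\<dots> = (1/2) *\<^sub>R (?Y (Suc n) ?u - ?Y n ?v)"
      by (simp add: scaleR_diff_right[symmetric] del: sqrt_iter.simps)
    also have "?Y (Suc n) ?u - ?Y n ?v = ?Y (Suc n) (?u - ?v) + (?Y (Suc n) ?v - ?Y n ?v)"
      using Ydiff[OF u v, of "Suc n"] by simp
    also have "norm ((1/2) *\<^sub>R \<dots>) \<le> (1/2) * (?a (Suc n) * norm (?u - ?v) + ?d * norm ?v)"
      using norm_triangle_ineq[of "?Y (Suc n) (?u - ?v)" "?Y (Suc n) ?v - ?Y n ?v"]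
        Ynorm[OF subspace_diff[OF A(1) u v], of "Suc n"] Suc.IH[OF v]
      by (simp del: sqrt_iter.simps sqrt_majorant.simps)
    also have "\<dots> \<le> (1/2) * (?a (Suc n) * (?d * norm f) + ?d * (?a n * norm f))"
      using Suc.IH[OF Suc.prems] Ynorm[OF Suc.prems, of n] d0 sqrt_majorant_bounds[of "Suc n"]
      by (intro mult_left_mono add_mono) (auto simp del: sqrt_iter.simps sqrt_majorant.simps)
    also have "\<dots> = ((?a (Suc n))\<^sup>2 - (?a n)\<^sup>2) / 2 * norm f"
      by (simp add: power2_eq_square algebra_simps del: sqrt_majorant.simps)
    also have "((?a (Suc n))\<^sup>2 - (?a n)\<^sup>2) / 2 = ?a (Suc (Suc n)) - ?a (Suc n)"
      by (subst sqrt_majorant.simps(2)[of "Suc n"], subst (2) sqrt_majorant.simps(2)[of n]) 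
         (simp add: field_simps del: sqrt_majorant.simps)
    finally show ?case .
  qed
  have tail: "norm (?Y (n + k) f - ?Y n f) \<le> (?a (n + k) - ?a n) * norm f" if f: "f \<in> A" for n k f
  proof (induction k)
    case (Suc k)
    have "norm (?Y (n + Suc k) f - ?Y n f)
        \<le> norm (?Y (Suc (n + k)) f - ?Y (n + k) f) + norm (?Y (n + k) f - ?Y n f)"
      using norm_triangle_ineq[of "?Y (Suc (n + k)) f - ?Y (n + k) f" "?Y (n + k) f - ?Y n f"]
      by (simp del: sqrt_iter.simps)
    also have "\<dots> \<le> (?a (n + Suc k) - ?a n) * norm f"
      using step[OF f, of "n + k"] Suc by (simp add: algebra_simps del: sqrt_iter.simps sqrt_majorant.simps)
    finally show ?case .
  qed simp
  have conv: "convergent (\<lambda>n. ?Y n f)" if f: "f \<in> A" for f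
  proof (rule Cauchy_convergent, rule CauchyI')
    fix e :: real assume e: "e > 0"
    have "e / (norm f + 1) > 0" using e by (simp add: add_nonneg_pos)
    from CauchyD[OF sqrt_majorant_Cauchy this] obtain N where
      N: "\<And>m n. m \<ge> N \<Longrightarrow> n \<ge> N \<Longrightarrow> \<bar>?a m - ?a n\<bar> < e / (norm f + 1)" by auto
    show "\<exists>N. \<forall>m\<ge>N. \<forall>n>m. dist (?Y m f) (?Y n f) < e"
    proof (intro exI[of _ N] allI impI)
      fix m n assume mn: "m \<ge> N" "n > m"
      have "norm (?Y m f - ?Y n f) \<le> (?a n - ?a m) * norm f"
        using tail[OF f, of m "n - m"] mn by (simp add: norm_minus_commute)
      also have "\<dots> \<le> \<bar>?a n - ?a m\<bar> * (norm f + 1)" by (intro mult_mono) auto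
      also have "\<dots> < e / (norm f + 1) * (norm f + 1)"
        using N[of n m] mn by (intro mult_strict_right_mono) (auto simp: add_nonneg_pos)
      also have "\<dots> = e" by (simp add: add_nonneg_eq_0_iff)
      finally show "dist (?Y m f) (?Y n f) < e" by (simp add: dist_norm)
    qed
  qed
  define Q where "Q f = lim (\<lambda>n. ?Y n f)" for f
  have lim: "(\<lambda>n. ?Y n f) \<longlonglongrightarrow> Q f" if "f \<in> A" for f
    unfolding Q_def using conv[OF that] convergent_LIMSEQ_iff by blast
  have QA: "Q f \<in> A" if "f \<in> A" for f
    using closed_sequentially[OF A(2) _ lim[OF that]] YA[OF that] by blast
  show thesis
  proof
    fix f assume f: "f \<in> A"
    show "Q f \<in> A" using QA[OF f] .
    show "norm (Q f) \<le> norm f"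
    proof (rule LIMSEQ_le_const2[OF tendsto_norm[OF lim[OF f]]], intro exI allI impI)
      fix n
      have "norm (?Y n f) \<le> ?a n * norm f" using Ynorm[OF f] .
      also have "\<dots> \<le> 1 * norm f" using sqrt_majorant_bounds by (intro mult_right_mono) auto
      finally show "norm (?Y n f) \<le> norm f" by simp
    qed
    show "Q (c *\<^sub>R f) = c *\<^sub>R Q f" for c
      using LIMSEQ_unique[OF lim[of "c *\<^sub>R f"] tendsto_scaleR[OF tendsto_const lim[OF f], of c, simplified Yscale[OF f, symmetric]]]
        A f by (simp add: subspace_scale)
    have "(\<lambda>n. ?Y n (?Y n f) - ?Y n (Q f)) \<longlonglongrightarrow> 0"
    proof (rule Lim_null_comparison)
      have "norm (?Y n (?Y n f) - ?Y n (Q f)) \<le> norm (?Y n f - Q f)" for n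
      proof -
        have d: "?Y n f - Q f \<in> A" using A YA[OF f] QA[OF f] by (simp add: subspace_diff)
        have "norm (?Y n (?Y n f) - ?Y n (Q f)) \<le> ?a n * norm (?Y n f - Q f)"
          using Ynorm[OF d] Ydiff[OF YA[OF f] QA[OF f]] by simp
        also have "\<dots> \<le> 1 * norm (?Y n f - Q f)"
          using sqrt_majorant_bounds by (intro mult_right_mono) auto
        finally show ?thesis by simp
      qed
      then show "\<forall>\<^sub>F n in sequentially. norm (?Y n (?Y n f) - ?Y n (Q f)) \<le> norm (?Y n f - Q f)" by simp
      show "(\<lambda>n. norm (?Y n f - Q f)) \<longlonglongrightarrow> 0"
        using lim[OF f] by (simp add: LIM_zero tendsto_norm_zero)
    qed
    from tendsto_add[OF this lim[OF QA[OF f]]]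
    have "(\<lambda>n. ?Y n (?Y n f)) \<longlonglongrightarrow> Q (Q f)" by simp
    then have "(\<lambda>n. ?Y (Suc n) f) \<longlonglongrightarrow> (1/2) *\<^sub>R (B f + Q (Q f))"
      by (auto intro!: tendsto_intros)
    moreover have "(\<lambda>n. ?Y (Suc n) f) \<longlonglongrightarrow> Q f" using lim[OF f] by (rule LIMSEQ_Suc)
    ultimately have "Q f = (1/2) *\<^sub>R (B f + Q (Q f))" using LIMSEQ_unique by blast
    then show "2 *\<^sub>R Q f = B f + Q (Q f)" by (metis scaleR_2 scaleR_half_double real_scaleR_def scaleR_scaleR one_add_one field_sum_of_halves scaleR_add_left scaleR_one)
  next
    fix f g assume f: "f \<in> A" and g: "g \<in> A"
    have "(\<lambda>n. ?Y n (f + g)) \<longlonglongrightarrow> Q f + Q g"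
      unfolding Yadd[OF f g] by (intro tendsto_add lim f g)
    with lim[OF subspace_add[OF A(1) f g]] show "Q (f + g) = Q f + Q g" by (rule LIMSEQ_unique)
    have "(\<lambda>n. inner f (?Y n g)) \<longlonglongrightarrow> inner f (Q g)" by (intro tendsto_intros lim g)
    moreover have "(\<lambda>n. inner f (?Y n g)) \<longlonglongrightarrow> inner (Q f) g"
      unfolding Ysym[OF f g] by (intro tendsto_intros lim f)
    ultimately show "inner f (Q g) = inner (Q f) g" by (rule LIMSEQ_unique)
  qed
qed

text \<open>
  If \<open>K > 0\<close> bounds the norm of \<open>P\<close>, then \<open>B = I - P/K\<close> is a contraction, and the fixed point
  \<open>Q\<close> belonging to \<open>B\<close> gives the root \<open>\<surd>K (I - Q)\<close> of \<open>P\<close>, which is positive since \<open>\<parallel>Q\<parallel> \<le> 1\<close>.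
\<close>
lemma positive_sqrt_exists:
  fixes A :: "'a::{real_inner,complete_space} set"
  assumes A: "subspace A" "closed A" and P: "bounded_op_on A A P"
    and sym: "\<And>f g. f \<in> A \<Longrightarrow> g \<in> A \<Longrightarrow> inner f (P g) = inner (P f) g"
    and pos: "\<And>f. f \<in> A \<Longrightarrow> inner f (P f) \<ge> 0"
  shows "\<exists>T. bounded_op_on A A T \<and> (\<forall>f\<in>A. \<forall>g\<in>A. inner f (T g) = inner (T f) g) \<and>
     (\<forall>f\<in>A. inner f (T f) \<ge> 0) \<and> (\<forall>f\<in>A. T (T f) = P f)"
proof -
  have PA: "P f \<in> A" if "f \<in> A" for f using P that unfolding bounded_op_on_def by auto
  have Padd: "P (f + g) = P f + P g" if "f \<in> A" "g \<in> A" for f g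
    using P that unfolding bounded_op_on_def by auto
  have Pscale: "P (c *\<^sub>R f) = c *\<^sub>R P f" if "f \<in> A" for c f
    using P that unfolding bounded_op_on_def by auto
  obtain K0 where K0: "\<And>f. f \<in> A \<Longrightarrow> norm (P f) \<le> K0 * norm f"
    using P unfolding bounded_op_on_def by blast
  define K where "K = \<bar>K0\<bar> + 1"
  have K: "K > 0" unfolding K_def by simp
  have PK: "norm (P f) \<le> K * norm f" if "f \<in> A" for f
  proof -
    have "K0 * norm f \<le> K * norm f" unfolding K_def by (intro mult_right_mono) auto
    then show ?thesis using K0[OF that] by simp
  qed
  define B where "B f = f - (1/K) *\<^sub>R P f" for f
  \<comment> \<open>positivity of \<open>P\<close> at the point \<open>f - P f / K\<close>\<close>
  have quad: "(norm (P f))\<^sup>2 \<le> K * inner f (P f)" if f: "f \<in> A" for f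
  proof -
    have Pf: "P f \<in> A" using PA[OF f] .
    have Bf: "f + (- 1/K) *\<^sub>R P f \<in> A" using A(1) f Pf by (intro subspace_add subspace_scale)
    have "0 \<le> inner (f + (-1/K) *\<^sub>R P f) (P (f + (-1/K) *\<^sub>R P f))" by (rule pos[OF Bf])
    also have "P (f + (-1/K) *\<^sub>R P f) = P f + (-1/K) *\<^sub>R P (P f)"
      using Padd[OF f subspace_scale[OF A(1) Pf]] Pscale[OF Pf] by metis
    also have "inner (f + (-1/K) *\<^sub>R P f) \<dots>
        = inner f (P f) - 2 / K * (norm (P f))\<^sup>2 + inner (P f) (P (P f)) / K\<^sup>2"
    proof -
      have "inner (u + s *\<^sub>R v) (v + s *\<^sub>R w) = inner u v + 2 * s * (norm v)\<^sup>2 + s\<^sup>2 * inner v w"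
        if "inner u w = inner v v" for u v w :: 'a and s
        using that by (simp only: power2_norm_eq_inner) (simp add: inner_add_left inner_add_right power2_eq_square algebra_simps)
      from this[OF sym[OF f Pf], of "-1/K"] show ?thesis by (simp add: power_divide)
    qed
    also have "inner (P f) (P (P f)) \<le> norm (P f) * (K * norm (P f))"
      using norm_cauchy_schwarz[of "P f" "P (P f)"] mult_left_mono[OF PK[OF Pf], of "norm (P f)"] by simp
    then have "inner (P f) (P (P f)) / K\<^sup>2 \<le> (norm (P f))\<^sup>2 / K"
      using K by (simp add: field_simps power2_eq_square)
    finally show ?thesis using K by (simp add: field_simps)
  qed
  have contr: "norm (B f) \<le> norm f" if f: "f \<in> A" for f
  proof -
    have "(norm (B f))\<^sup>2 = (norm f)\<^sup>2 - 2 / K * inner f (P f) + (norm (P f))\<^sup>2 / K\<^sup>2"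
      unfolding B_def power2_norm_eq_inner using K
      by (simp add: inner_diff_left inner_diff_right inner_commute power2_eq_square field_simps)
    moreover have "(norm (P f))\<^sup>2 / K\<^sup>2 \<le> inner f (P f) / K"
      using quad[OF f] K by (simp add: field_simps power2_eq_square)
    moreover have "inner f (P f) / K \<ge> 0" using pos[OF f] K by simp
    ultimately have "(norm (B f))\<^sup>2 \<le> (norm f)\<^sup>2" by simp
    then show ?thesis by simp
  qed
  obtain Q where QA: "\<And>f. f \<in> A \<Longrightarrow> Q f \<in> A"
    and Qadd: "\<And>f g. f \<in> A \<Longrightarrow> g \<in> A \<Longrightarrow> Q (f + g) = Q f + Q g"
    and Qscale: "\<And>c f. f \<in> A \<Longrightarrow> Q (c *\<^sub>R f) = c *\<^sub>R Q f"
    and Qnorm: "\<And>f. f \<in> A \<Longrightarrow> norm (Q f) \<le> norm f"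
    and Qsym: "\<And>f g. f \<in> A \<Longrightarrow> g \<in> A \<Longrightarrow> inner f (Q g) = inner (Q f) g"
    and Qeq: "\<And>f. f \<in> A \<Longrightarrow> 2 *\<^sub>R Q f = B f + Q (Q f)"
  proof (rule contraction_fixpoint_square[OF A, of B])
    show "B f \<in> A" if "f \<in> A" for f
      unfolding B_def using A(1) PA that by (intro subspace_diff subspace_scale)
    show "B (f + g) = B f + B g" if "f \<in> A" "g \<in> A" for f g
      unfolding B_def using Padd that by (simp add: algebra_simps)
    show "B (c *\<^sub>R f) = c *\<^sub>R B f" if "f \<in> A" for f c
      unfolding B_def using Pscale that by (simp add: algebra_simps)
    show "inner f (B g) = inner (B f) g" if "f \<in> A" "g \<in> A" for f g
      unfolding B_def using sym[OF that] by (simp add: inner_diff_left inner_diff_right)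
  qed (use contr in blast)+
  define T where "T f = sqrt K *\<^sub>R (f - Q f)" for f
  have TA: "T f \<in> A" if "f \<in> A" for f
    unfolding T_def using A(1) QA that by (intro subspace_diff subspace_scale)
  have Tadd: "T (f + g) = T f + T g" if "f \<in> A" "g \<in> A" for f g
    unfolding T_def using Qadd[OF that] by (simp add: algebra_simps)
  have Tscale: "T (c *\<^sub>R f) = c *\<^sub>R T f" if "f \<in> A" for c f
    unfolding T_def using Qscale[OF that] by (simp add: algebra_simps)
  have Tnorm: "norm (T f) \<le> (sqrt K * 2) * norm f" if "f \<in> A" for f
  proof -
    have "norm (f - Q f) \<le> 2 * norm f"
      using norm_triangle_ineq4[of f "Q f"] Qnorm[OF that] by linarith
    then show ?thesis unfolding T_def using K by simp
  qed
  have Tsq: "T (T f) = P f" if f: "f \<in> A" for f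
  proof -
    have "Q f = Q (f - Q f) + Q (Q f)"
      using Qadd[of "f - Q f" "Q f"] f QA A(1) by (simp add: subspace_diff)
    then have "Q (f - Q f) = Q f - Q (Q f)" by (simp add: eq_diff_eq)
    then have "T (T f) = K *\<^sub>R ((f - Q f) - (Q f - Q (Q f)))"
      unfolding T_def using K Qscale[of "f - Q f"] f QA A(1)
      by (simp add: subspace_diff flip: scaleR_diff_right)
    also have "(f - Q f) - (Q f - Q (Q f)) = f - B f"
      using Qeq[OF f] by (simp add: scaleR_2 algebra_simps)
    also have "K *\<^sub>R (f - B f) = P f" unfolding B_def using K by simp
    finally show ?thesis .
  qed
  have "inner f (T f) \<ge> 0" if f: "f \<in> A" for f
  proof -
    have "inner f (Q f) \<le> norm f * norm f"
      using norm_cauchy_schwarz[of f "Q f"] mult_left_mono[OF Qnorm[OF f], of "norm f"] by simp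
    then have "0 \<le> inner f (f - Q f)"
      by (simp add: inner_diff_right power2_norm_eq_inner[symmetric] power2_eq_square)
    then show ?thesis unfolding T_def using K by simp
  qed
  moreover have "inner f (T g) = inner (T f) g" if "f \<in> A" "g \<in> A" for f g
    unfolding T_def using Qsym[OF that] by (simp add: inner_diff_left inner_diff_right)
  ultimately show ?thesis
    unfolding bounded_op_on_def using TA Tadd Tscale Tnorm Tsq
    by (intro exI[of _ T] conjI) (auto intro: exI[of _ "sqrt K * 2"])
qed

section \<open>Mean-zero square-integrable functions\<close>

definition square_integrable :: "'x measure \<Rightarrow> ('x \<Rightarrow> real) \<Rightarrow> bool" where
  "square_integrable P f \<longleftrightarrow> f \<in> borel_measurable P \<and> integrable P (\<lambda>x. (f x)\<^sup>2)"

lemma square_integrable_mult: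
  assumes "square_integrable P f" "square_integrable P g"
  shows "integrable P (\<lambda>x. f x * g x)"
proof (rule Bochner_Integration.integrable_bound)
  show "integrable P (\<lambda>x. (f x)\<^sup>2 + (g x)\<^sup>2)"
    using assms unfolding square_integrable_def by auto
  show "(\<lambda>x. f x * g x) \<in> borel_measurable P"
    using assms unfolding square_integrable_def by auto
  have "\<bar>a * b\<bar> \<le> a\<^sup>2 + b\<^sup>2" for a b :: real
  proof -
    have "2 * \<bar>a * b\<bar> \<le> a\<^sup>2 + b\<^sup>2"
      using sum_squares_bound[of "\<bar>a\<bar>" "\<bar>b\<bar>"] by (simp add: abs_mult)
    then show ?thesis using abs_ge_zero[of "a * b"] by linarith
  qed
  then show "AE x in P. norm (f x * g x) \<le> norm ((f x)\<^sup>2 + (g x)\<^sup>2)" by simp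
qed

lemma square_integrable_add:
  assumes f: "square_integrable P f" and g: "square_integrable P g"
  shows "square_integrable P (\<lambda>x. f x + g x)"
proof -
  have "integrable P (\<lambda>x. (f x)\<^sup>2 + (g x)\<^sup>2 + 2 * (f x * g x))"
    using square_integrable_mult[OF f g] f g unfolding square_integrable_def by auto
  then show ?thesis
    using f g unfolding square_integrable_def by (auto simp: power2_sum algebra_simps)
qed

lemma square_integrable_scale:
  assumes "square_integrable P f"
  shows "square_integrable P (\<lambda>x. c * f x)"
  using assms unfolding square_integrable_def by (auto simp: power_mult_distrib)

lemma square_integrable_diff:
  assumes "square_integrable P f" "square_integrable P g"
  shows "square_integrable P (\<lambda>x. f x - g x)"
  using square_integrable_add[OF assms(1) square_integrable_scale[OF assms(2), of "-1"]] by simp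

lemma L2_norm_power2: "(L2_norm P f)\<^sup>2 = (\<integral>x. (f x)\<^sup>2 \<partial>P)"
  unfolding L2_norm_def L2_inner_def by (simp add: power2_eq_square flip: power2_eq_square)

lemma L2_norm_nonneg: "0 \<le> L2_norm P f"
  unfolding L2_norm_def L2_inner_def by simp

lemma L2_inner_self: "L2_inner P f f = (L2_norm P f)\<^sup>2"
  unfolding L2_norm_power2 L2_inner_def by (simp add: power2_eq_square)

lemma L2_inner_commute: "L2_inner P f g = L2_inner P g f"
  unfolding L2_inner_def by (simp add: mult.commute)

lemma L2_inner_add_left:
  assumes "square_integrable P f" "square_integrable P g" "square_integrable P h"
  shows "L2_inner P (\<lambda>x. f x + g x) h = L2_inner P f h + L2_inner P g h"
  unfolding L2_inner_def
  using square_integrable_mult[OF assms(1,3)] square_integrable_mult[OF assms(2,3)]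
  by (simp add: distrib_right)

lemma L2_inner_scale_left: "L2_inner P (\<lambda>x. c * f x) h = c * L2_inner P f h"
  unfolding L2_inner_def by (simp add: mult.assoc)

lemma L2_inner_diff_left:
  assumes "square_integrable P f" "square_integrable P g" "square_integrable P h"
  shows "L2_inner P (\<lambda>x. f x - g x) h = L2_inner P f h - L2_inner P g h"
  unfolding L2_inner_def
  using square_integrable_mult[OF assms(1,3)] square_integrable_mult[OF assms(2,3)]
  by (simp add: left_diff_distrib)

lemma L2_norm_add_power2:
  assumes "square_integrable P f" "square_integrable P g"
  shows "(L2_norm P (\<lambda>x. f x + g x))\<^sup>2 = (L2_norm P f)\<^sup>2 + 2 * L2_inner P f g + (L2_norm P g)\<^sup>2"
proof -
  have "(\<integral>x. (f x + g x)\<^sup>2 \<partial>P) = (\<integral>x. (f x)\<^sup>2 + 2 * (f x * g x) + (g x)\<^sup>2 \<partial>P)"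
    by (simp add: power2_sum algebra_simps)
  also have "\<dots> = (\<integral>x. (f x)\<^sup>2 \<partial>P) + 2 * (\<integral>x. f x * g x \<partial>P) + (\<integral>x. (g x)\<^sup>2 \<partial>P)"
    using square_integrable_mult[OF assms] assms unfolding square_integrable_def by simp
  finally show ?thesis unfolding L2_norm_power2 L2_inner_def .
qed

lemma L2_norm_scale: "L2_norm P (\<lambda>x. c * f x) = \<bar>c\<bar> * L2_norm P f"
proof (rule power2_eq_imp_eq)
  show "(L2_norm P (\<lambda>x. c * f x))\<^sup>2 = (\<bar>c\<bar> * L2_norm P f)\<^sup>2"
    by (simp add: power_mult_distrib L2_norm_power2)
qed (auto simp: L2_norm_nonneg)

lemma L2_norm_minus_commute: "L2_norm P (\<lambda>x. f x - g x) = L2_norm P (\<lambda>x. g x - f x)"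
  using L2_norm_scale[of P "-1" "\<lambda>x. f x - g x"] by simp

text \<open>
  The quadratic polynomial \<open>t \<mapsto> \<parallel>f + t g\<parallel>\<^sup>2\<close> is nonnegative.
\<close>
lemma L2_Cauchy_Schwarz:
  assumes f: "square_integrable P f" and g: "square_integrable P g"
  shows "\<bar>L2_inner P f g\<bar> \<le> L2_norm P f * L2_norm P g"
proof -
  let ?a = "(L2_norm P f)\<^sup>2" and ?b = "L2_inner P f g" and ?c = "(L2_norm P g)\<^sup>2"
  have quad: "0 \<le> ?a + 2 * t * ?b + t\<^sup>2 * ?c" for t
  proof -
    have "0 \<le> (L2_norm P (\<lambda>x. f x + t * g x))\<^sup>2" by simp
    also have "\<dots> = ?a + 2 * L2_inner P f (\<lambda>x. t * g x) + (L2_norm P (\<lambda>x. t * g x))\<^sup>2"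
      by (rule L2_norm_add_power2[OF f square_integrable_scale[OF g]])
    also have "L2_inner P f (\<lambda>x. t * g x) = t * ?b"
      using L2_inner_scale_left[of P t g f] by (simp add: L2_inner_commute)
    finally show ?thesis by (simp add: L2_norm_scale power_mult_distrib)
  qed
  have "?b\<^sup>2 \<le> ?a * ?c"
  proof (cases "?c = 0")
    case True
    have "?b = 0"
    proof (rule ccontr)
      assume b: "?b \<noteq> 0"
      then show False using quad[of "- (?a + 1) / (2 * ?b)"] True by (simp add: field_simps)
    qed
    then show ?thesis using True by simp
  next
    case False
    then have "?c > 0" by simp
    have "2 * (- ?b / ?c) * ?b + (- ?b / ?c)\<^sup>2 * ?c = - (?b\<^sup>2 / ?c)"
      using False by (simp add: power_divide power2_eq_square[of ?b] field_simps)
    then have "?b\<^sup>2 / ?c \<le> ?a" using quad[of "- ?b / ?c"] by linarith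
    then show ?thesis using \<open>?c > 0\<close> by (simp add: field_simps)
  qed
  then have "\<bar>?b\<bar>\<^sup>2 \<le> (L2_norm P f * L2_norm P g)\<^sup>2" by (simp add: power_mult_distrib)
  then show ?thesis by (rule power2_le_imp_le) (simp add: L2_norm_nonneg)
qed

lemma L2_norm_triangle:
  assumes f: "square_integrable P f" and g: "square_integrable P g"
  shows "L2_norm P (\<lambda>x. f x + g x) \<le> L2_norm P f + L2_norm P g"
proof (rule power2_le_imp_le)
  show "(L2_norm P (\<lambda>x. f x + g x))\<^sup>2 \<le> (L2_norm P f + L2_norm P g)\<^sup>2"
    using L2_norm_add_power2[OF f g] L2_Cauchy_Schwarz[OF f g] by (simp add: power2_sum)
qed (simp add: L2_norm_nonneg)

lemma L2_norm_triangle_diff: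
  assumes "square_integrable P f" "square_integrable P g" "square_integrable P h"
  shows "L2_norm P (\<lambda>x. f x - h x) \<le> L2_norm P (\<lambda>x. f x - g x) + L2_norm P (\<lambda>x. g x - h x)"
  using L2_norm_triangle[OF square_integrable_diff[OF assms(1,2)] square_integrable_diff[OF assms(2,3)]]
  by simp

lemma L2_norm_cong_AE:
  assumes "AE x in P. f x = g x" "f \<in> borel_measurable P" "g \<in> borel_measurable P"
  shows "L2_norm P f = L2_norm P g"
  unfolding L2_norm_def L2_inner_def using assms by (auto intro!: integral_cong_AE arg_cong[where f = sqrt])

lemma (in prob_space) square_integrable_const: "square_integrable M (\<lambda>x. c)"
  unfolding square_integrable_def by simp

lemma (in prob_space) square_integrable_imp_integrable_self:
  assumes "square_integrable M f"
  shows "integrable M f"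
  using square_integrable_mult[OF assms square_integrable_const[of 1]] by simp

lemma (in prob_space) integral_abs_le_L2_norm:
  assumes f: "square_integrable M f"
  shows "(\<integral>x. \<bar>f x\<bar> \<partial>M) \<le> L2_norm M f"
proof -
  have abs: "square_integrable M (\<lambda>x. \<bar>f x\<bar>)" using f unfolding square_integrable_def by auto
  have "\<bar>L2_inner M (\<lambda>x. \<bar>f x\<bar>) (\<lambda>x. 1)\<bar> \<le> L2_norm M (\<lambda>x. \<bar>f x\<bar>) * L2_norm M (\<lambda>x. 1)"
    by (rule L2_Cauchy_Schwarz[OF abs square_integrable_const])
  moreover have "L2_norm M (\<lambda>x. 1) = 1" unfolding L2_norm_def L2_inner_def by (simp add: prob_space)
  moreover have "L2_norm M (\<lambda>x. \<bar>f x\<bar>) = L2_norm M f" unfolding L2_norm_def L2_inner_def by simp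
  ultimately show ?thesis unfolding L2_inner_def by simp
qed

lemma L2_iff: "f \<in> L2 P \<longleftrightarrow> square_integrable P f \<and> (\<integral>x. f x \<partial>P) = 0"
  unfolding L2_def square_integrable_def by auto

lemma L2_square_integrable: "f \<in> L2 P \<Longrightarrow> square_integrable P f"
  unfolding L2_iff by simp

context prob_space
begin

lemma L2_add: "f \<in> L2 M \<Longrightarrow> g \<in> L2 M \<Longrightarrow> (\<lambda>x. f x + g x) \<in> L2 M"
  unfolding L2_iff using square_integrable_imp_integrable_self square_integrable_add by auto

lemma L2_scale: "f \<in> L2 M \<Longrightarrow> (\<lambda>x. c * f x) \<in> L2 M"
  unfolding L2_iff using square_integrable_scale by auto

lemma L2_diff: "f \<in> L2 M \<Longrightarrow> g \<in> L2 M \<Longrightarrow> (\<lambda>x. f x - g x) \<in> L2 M"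
  unfolding L2_iff using square_integrable_imp_integrable_self square_integrable_diff by auto

lemma centered_in_L2:
  assumes "square_integrable M f"
  shows "(\<lambda>x. f x - (\<integral>z. f z \<partial>M)) \<in> L2 M"
  unfolding L2_iff
  using square_integrable_imp_integrable_self[OF assms] square_integrable_diff[OF assms square_integrable_const]
  by (simp add: prob_space)

text \<open>
  Riesz-Fischer. Along a subsequence whose increments have norms below \<open>2\<^sup>-\<^sup>k\<close> the absolute increments
  have a finite sum almost everywhere, so the subsequence converges almost everywhere; by
  Fatou's lemma the limit is also the limit in norm of the whole sequence.
\<close>
lemma L2_complete:
  assumes fL2: "\<And>n. f n \<in> L2 M"
    and Cauchy: "\<And>e. e > 0 \<Longrightarrow> \<exists>N. \<forall>m\<ge>N. \<forall>n\<ge>N. L2_norm M (\<lambda>x. f m x - f n x) < e"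
  shows "\<exists>F\<in>L2 M. (\<lambda>n. L2_norm M (\<lambda>x. f n x - F x)) \<longlonglongrightarrow> 0"
proof -
  have sq: "square_integrable M (f n)" for n using fL2 by (rule L2_square_integrable)
  then have meas[measurable]: "f n \<in> borel_measurable M" for n unfolding square_integrable_def by simp
  have "\<exists>N. \<forall>m\<ge>N. \<forall>n\<ge>N. L2_norm M (\<lambda>x. f m x - f n x) < (1/2)^k" for k :: nat
    by (rule Cauchy) simp
  then obtain N where N: "\<And>k m n. m \<ge> N k \<Longrightarrow> n \<ge> N k \<Longrightarrow> L2_norm M (\<lambda>x. f m x - f n x) < (1/2)^k"
    by metis
  \<comment> \<open>partial sums make the indices increasing and at least \<open>N k\<close>\<close>
  define r where "r k = (\<Sum>i\<le>k. N i)" for k :: nat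
  have r_ge: "r k \<ge> N k" for k unfolding r_def by (simp add: member_le_sum)
  have r_mono: "r k \<le> r (Suc k)" for k unfolding r_def by simp
  have r_mono': "j \<le> k \<Longrightarrow> r j \<le> r k" for j k using r_mono by (rule lift_Suc_mono_le)
  define d where "d k x = f (r (Suc k)) x - f (r k) x" for k x
  have dmeas[measurable]: "d k \<in> borel_measurable M" for k unfolding d_def by measurable
  have d_sq: "square_integrable M (d k)" for k
    unfolding d_def by (intro square_integrable_diff sq)
  have d_int: "(\<integral>x. \<bar>d k x\<bar> \<partial>M) \<le> (1/2)^k" for k
    using integral_abs_le_L2_norm[OF d_sq[of k]] N[of k "r (Suc k)" "r k"] r_ge[of k] r_mono[of k]
    unfolding d_def by simp
  have d_nn: "(\<integral>\<^sup>+x. ennreal \<bar>d k x\<bar> \<partial>M) \<le> ennreal ((1/2)^k)" for k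
    using d_int[of k] square_integrable_imp_integrable_self[OF d_sq[of k]]
    by (subst nn_integral_eq_integral) (auto intro: ennreal_leI)
  have "(\<integral>\<^sup>+x. (\<Sum>k. ennreal \<bar>d k x\<bar>) \<partial>M) = (\<Sum>k. \<integral>\<^sup>+x. ennreal \<bar>d k x\<bar> \<partial>M)"
    by (rule nn_integral_suminf) simp
  also have "\<dots> \<le> (\<Sum>k. ennreal ((1/2)^k))" by (rule suminf_le[OF d_nn]) auto
  also have "\<dots> = ennreal (\<Sum>k. (1/2)^k)" by (rule suminf_ennreal2) auto
  also have "\<dots> < \<infinity>" by simp
  finally have "AE x in M. (\<Sum>k. ennreal \<bar>d k x\<bar>) \<noteq> \<infinity>"
    by (intro nn_integral_PInf_AE) auto
  then have AEconv: "AE x in M. convergent (\<lambda>k. f (r k) x)"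
  proof eventually_elim
    case (elim x)
    then have "summable (\<lambda>k. \<bar>d k x\<bar>)" by (intro summable_suminf_not_top) auto
    then have "summable (\<lambda>k. d k x)" by (rule summable_rabs_cancel)
    then have "convergent (\<lambda>n. \<Sum>k<n. d k x)" by (simp add: summable_iff_convergent)
    moreover have "(\<Sum>k<n. d k x) = f (r n) x - f (r 0) x" for n
      unfolding d_def by (rule sum_lessThan_telescope)
    ultimately have "convergent (\<lambda>n. f (r n) x - f (r 0) x)" by simp
    from convergent_add[OF this convergent_const[of "f (r 0) x"]] show ?case by simp
  qed
  define F where "F x = lim (\<lambda>k. f (r k) x)" for x
  have Fmeas[measurable]: "F \<in> borel_measurable M" unfolding F_def by measurable
  have bound: "square_integrable M (\<lambda>x. f n x - F x) \<and> L2_norm M (\<lambda>x. f n x - F x) \<le> (1/2)^j"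
    if n: "n \<ge> N j" for n j
  proof -
    have pw: "AE x in M. (\<lambda>k. ennreal ((f n x - f (r k) x)\<^sup>2)) \<longlonglongrightarrow> ennreal ((f n x - F x)\<^sup>2)"
      using AEconv
    proof eventually_elim
      case (elim x)
      then have "(\<lambda>k. f (r k) x) \<longlonglongrightarrow> F x" unfolding F_def by (simp add: convergent_LIMSEQ_iff)
      then show ?case by (intro tendsto_ennrealI tendsto_intros)
    qed
    have "(\<integral>\<^sup>+x. ennreal ((f n x - F x)\<^sup>2) \<partial>M)
        = (\<integral>\<^sup>+x. liminf (\<lambda>k. ennreal ((f n x - f (r k) x)\<^sup>2)) \<partial>M)"
      using pw by (intro nn_integral_cong_AE) (erule eventually_mono, rule lim_imp_Liminf[symmetric], simp_all)
    also have "\<dots> \<le> liminf (\<lambda>k. \<integral>\<^sup>+x. ennreal ((f n x - f (r k) x)\<^sup>2) \<partial>M)"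
      by (rule nn_integral_liminf) simp
    also have "\<dots> \<le> ennreal (((1/2)^j)\<^sup>2)"
    proof -
      have "(\<integral>\<^sup>+x. ennreal ((f n x - f (r k) x)\<^sup>2) \<partial>M) \<le> ennreal (((1/2)^j)\<^sup>2)" if "k \<ge> j" for k
      proof -
        have "integrable M (\<lambda>x. (f n x - f (r k) x)\<^sup>2)"
          using square_integrable_diff[OF sq sq] unfolding square_integrable_def by simp
        then have "(\<integral>\<^sup>+x. ennreal ((f n x - f (r k) x)\<^sup>2) \<partial>M) = ennreal ((L2_norm M (\<lambda>x. f n x - f (r k) x))\<^sup>2)"
          unfolding L2_norm_power2 by (intro nn_integral_eq_integral) auto
        moreover have "L2_norm M (\<lambda>x. f n x - f (r k) x) \<le> (1/2)^j"
          using N[of j n "r k"] n order_trans[OF r_ge[of j] r_mono'[OF that]] by (auto intro: less_imp_le)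
        ultimately show ?thesis by (auto intro!: ennreal_leI power_mono simp: L2_norm_nonneg)
      qed
      then have "\<forall>\<^sub>F k in sequentially. (\<integral>\<^sup>+x. ennreal ((f n x - f (r k) x)\<^sup>2) \<partial>M) \<le> ennreal (((1/2)^j)\<^sup>2)"
        by (auto simp: eventually_sequentially)
      from Liminf_mono[OF this] show ?thesis by (simp add: Liminf_const)
    qed
    finally have le: "(\<integral>\<^sup>+x. ennreal ((f n x - F x)\<^sup>2) \<partial>M) \<le> ennreal (((1/2)^j)\<^sup>2)" .
    then have "(\<integral>\<^sup>+x. ennreal (norm ((f n x - F x)\<^sup>2)) \<partial>M) < \<infinity>"
      by (auto intro: le_less_trans)
    then have int: "integrable M (\<lambda>x. (f n x - F x)\<^sup>2)" by (intro integrableI_bounded) auto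
    have "ennreal (\<integral>x. (f n x - F x)\<^sup>2 \<partial>M) \<le> ennreal (((1/2)^j)\<^sup>2)"
      using le nn_integral_eq_integral[OF int] by simp
    then have "(L2_norm M (\<lambda>x. f n x - F x))\<^sup>2 \<le> ((1/2)^j)\<^sup>2"
      unfolding L2_norm_power2 by (subst (asm) ennreal_le_iff) auto
    then have "L2_norm M (\<lambda>x. f n x - F x) \<le> (1/2)^j" by (rule power2_le_imp_le) simp
    then show ?thesis using int unfolding square_integrable_def by simp
  qed
  have "square_integrable M (\<lambda>x. f (N 0) x - (f (N 0) x - F x))"
    using bound[of 0 "N 0"] square_integrable_diff[OF sq] by blast
  then have Fsq: "square_integrable M F" by simp
  have small: "\<exists>j::nat. (1/2)^j < e" if "e > 0" for e :: real
    using real_arch_pow_inv[OF that, of "1/2"] by simp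
  have "\<bar>\<integral>x. F x \<partial>M\<bar> \<le> e" if e: "e > 0" for e
  proof -
    obtain j :: nat where j: "(1/2)^j < e" using small[OF e] by blast
    have "(\<integral>x. F x \<partial>M) = - (\<integral>x. f (N j) x - F x \<partial>M)"
      using fL2[of "N j"] square_integrable_imp_integrable_self[OF Fsq]
        square_integrable_imp_integrable_self[OF sq[of "N j"]] by (simp add: L2_iff)
    then have "\<bar>\<integral>x. F x \<partial>M\<bar> \<le> (\<integral>x. \<bar>f (N j) x - F x\<bar> \<partial>M)"
      using integral_abs_bound[of M "\<lambda>x. f (N j) x - F x"] by simp
    also have "\<dots> \<le> L2_norm M (\<lambda>x. f (N j) x - F x)"
      using bound[of j "N j"] by (intro integral_abs_le_L2_norm) simp
    also have "\<dots> \<le> (1/2)^j" using bound[of j "N j"] by simp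
    finally show ?thesis using j by simp
  qed
  then have "\<bar>\<integral>x. F x \<partial>M\<bar> \<le> 0" by (rule field_le_epsilon) simp
  then have "F \<in> L2 M" using Fsq unfolding L2_iff by simp
  moreover have "(\<lambda>n. L2_norm M (\<lambda>x. f n x - F x)) \<longlonglongrightarrow> 0"
  proof (rule LIMSEQ_I)
    fix e :: real assume "e > 0"
    then obtain j :: nat where j: "(1/2)^j < e" using small by blast
    show "\<exists>no. \<forall>n\<ge>no. norm (L2_norm M (\<lambda>x. f n x - F x) - 0) < e"
    proof (intro exI[of _ "N j"] allI impI)
      fix n assume "n \<ge> N j"
      then show "norm (L2_norm M (\<lambda>x. f n x - F x) - 0) < e"
        using bound[of j n] j by (simp add: L2_norm_nonneg)
    qed
  qed
  ultimately show ?thesis by blast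
qed

end

section \<open>The pairing of functions of two random elements\<close>

text \<open>
  The bilinear form \<open>\<integral> f(Y) g(X)\<close>. On mean-zero functions it is the covariance of \<open>f(Y)\<close> and \<open>g(X)\<close>; for
  \<open>Y = X\<close> it is the inner product of \<open>L\<^sub>2\<close>, which lets one argument treat variances and cross-covariances.
\<close>
definition pairing :: "'w measure \<Rightarrow> ('w \<Rightarrow> 'y) \<Rightarrow> ('w \<Rightarrow> 'x) \<Rightarrow> ('y \<Rightarrow> real) \<Rightarrow> ('x \<Rightarrow> real) \<Rightarrow> real" where
  "pairing M Y X f g = (\<integral>w. f (Y w) * g (X w) \<partial>M)"

lemma square_integrable_distr:
  assumes "X \<in> measurable M MX" "square_integrable (distr M MX X) f"
  shows "square_integrable M (\<lambda>w. f (X w))"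
  using assms unfolding square_integrable_def
  by (auto simp: integrable_distr_eq intro: measurable_compose)

lemma L2_norm_distr:
  assumes "X \<in> measurable M MX" "square_integrable (distr M MX X) f"
  shows "L2_norm M (\<lambda>w. f (X w)) = L2_norm (distr M MX X) f"
proof -
  have "f \<in> borel_measurable MX" using assms(2) unfolding square_integrable_def by simp
  then show ?thesis unfolding L2_norm_def L2_inner_def using assms(1) by (simp add: integral_distr)
qed

lemma pairing_self:
  assumes "X \<in> measurable M MX" "square_integrable (distr M MX X) f" "square_integrable (distr M MX X) g"
  shows "pairing M X X f g = L2_inner (distr M MX X) f g"
proof -
  have "f \<in> borel_measurable MX" "g \<in> borel_measurable MX"
    using assms(2,3) unfolding square_integrable_def by simp_all
  then show ?thesis unfolding pairing_def L2_inner_def using assms(1) by (simp add: integral_distr)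
qed

lemma pairing_commute: "pairing M Y X f g = pairing M X Y g f"
  unfolding pairing_def by (simp add: mult.commute)

lemma pairing_bound:
  assumes "X \<in> measurable M MX" "Y \<in> measurable M MY"
    and "square_integrable (distr M MY Y) f" "square_integrable (distr M MX X) g"
  shows "\<bar>pairing M Y X f g\<bar> \<le> L2_norm (distr M MY Y) f * L2_norm (distr M MX X) g"
  using L2_Cauchy_Schwarz[OF square_integrable_distr[OF assms(2,3)] square_integrable_distr[OF assms(1,4)]]
  unfolding L2_norm_distr[OF assms(2,3)] L2_norm_distr[OF assms(1,4)] pairing_def L2_inner_def .

lemma pairing_add_left:
  assumes "X \<in> measurable M MX" "Y \<in> measurable M MY"
    and "square_integrable (distr M MY Y) f" "square_integrable (distr M MY Y) f'"
    and "square_integrable (distr M MX X) g"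
  shows "pairing M Y X (\<lambda>y. f y + f' y) g = pairing M Y X f g + pairing M Y X f' g"
  using L2_inner_add_left[OF square_integrable_distr[OF assms(2,3)]
      square_integrable_distr[OF assms(2,4)] square_integrable_distr[OF assms(1,5)]]
  unfolding pairing_def L2_inner_def .

lemma pairing_diff_left:
  assumes "X \<in> measurable M MX" "Y \<in> measurable M MY"
    and "square_integrable (distr M MY Y) f" "square_integrable (distr M MY Y) f'"
    and "square_integrable (distr M MX X) g"
  shows "pairing M Y X (\<lambda>y. f y - f' y) g = pairing M Y X f g - pairing M Y X f' g"
  using L2_inner_diff_left[OF square_integrable_distr[OF assms(2,3)]
      square_integrable_distr[OF assms(2,4)] square_integrable_distr[OF assms(1,5)]]
  unfolding pairing_def L2_inner_def .

lemma pairing_scale_left: "pairing M Y X (\<lambda>y. c * f y) g = c * pairing M Y X f g"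
  unfolding pairing_def by (simp add: mult.assoc)

lemma pairing_cong:
  assumes "X \<in> measurable M MX" "Y \<in> measurable M MY"
    and "\<And>y. y \<in> space MY \<Longrightarrow> f y = f' y" "\<And>x. x \<in> space MX \<Longrightarrow> g x = g' x"
  shows "pairing M Y X f g = pairing M Y X f' g'"
  unfolding pairing_def
  by (rule Bochner_Integration.integral_cong)
     (auto simp: assms(3)[OF measurable_space[OF assms(2)]] assms(4)[OF measurable_space[OF assms(1)]])

section \<open>Covariance operators and their square roots\<close>

text \<open>
  One random element with a Hilbert space of functions that is dense modulo constants
  in \<open>L\<^sub>2\<close> and on which the variance is a bounded quadratic form.
\<close>
locale covariance_setting = prob_space M for M :: "'w measure" +
  fixes MX :: "'x measure" and X :: "'w \<Rightarrow> 'x"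
    and evl :: "'h::{real_inner, complete_space} \<Rightarrow> 'x \<Rightarrow> real"
  assumes X[measurable]: "X \<in> measurable M MX"
    and evl: "function_space_on (space MX) evl"
    and dense: "dense_L2_mod_const (range evl) (distr M MX X)"
    and var_bound: "\<exists>C>0. \<forall>f. variance (\<lambda>w. evl f (X w)) \<le> C * (norm f)\<^sup>2"
begin

abbreviation "P \<equiv> distr M MX X"

sublocale P: prob_space P
  by (rule prob_space_distr) simp

definition J :: "'h \<Rightarrow> 'x \<Rightarrow> real" where
  "J h = (\<lambda>x. evl h x - (\<integral>w. evl h (X w) \<partial>M))"

lemma evl_square_integrable: "square_integrable P (evl h)"
proof -
  obtain c where "(\<lambda>x. evl h x + c) \<in> L2 P"
    using dense unfolding dense_L2_mod_const_def subset_mod_const_def by blast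
  from square_integrable_diff[OF L2_square_integrable[OF this] P.square_integrable_const[of c]]
  show ?thesis by simp
qed

lemma evl_measurable[measurable]: "evl h \<in> borel_measurable MX"
  using evl_square_integrable[of h] unfolding square_integrable_def by simp

lemma evl_mean: "(\<integral>w. evl h (X w) \<partial>M) = (\<integral>x. evl h x \<partial>P)"
  by (simp add: integral_distr)

lemma J_L2: "J h \<in> L2 P"
  unfolding J_def evl_mean by (rule P.centered_in_L2[OF evl_square_integrable])

lemma J_sq: "square_integrable P (J h)"
  using J_L2 by (rule L2_square_integrable)

lemma evl_integrable: "integrable P (evl h)"
  by (rule P.square_integrable_imp_integrable_self[OF evl_square_integrable])

lemma evl_add: "x \<in> space MX \<Longrightarrow> evl (f + g) x = evl f x + evl g x"
  and evl_scale: "x \<in> space MX \<Longrightarrow> evl (c *\<^sub>R f) x = c * evl f x"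
  using evl unfolding function_space_on_def by (auto simp: linear_iff)

lemma J_add: "x \<in> space MX \<Longrightarrow> J (f + g) x = J f x + J g x"
proof -
  have "(\<integral>x. evl (f + g) x \<partial>P) = (\<integral>x. evl f x + evl g x \<partial>P)"
    by (rule Bochner_Integration.integral_cong) (auto simp: evl_add)
  also have "\<dots> = (\<integral>x. evl f x \<partial>P) + (\<integral>x. evl g x \<partial>P)"
    using evl_integrable by simp
  finally show "x \<in> space MX \<Longrightarrow> J (f + g) x = J f x + J g x"
    unfolding J_def evl_mean by (simp add: evl_add)
qed

lemma J_scale: "x \<in> space MX \<Longrightarrow> J (c *\<^sub>R f) x = c * J f x"
proof -
  have "(\<integral>x. evl (c *\<^sub>R f) x \<partial>P) = (\<integral>x. c * evl f x \<partial>P)"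
    by (rule Bochner_Integration.integral_cong) (auto simp: evl_scale)
  then show "x \<in> space MX \<Longrightarrow> J (c *\<^sub>R f) x = c * J f x"
    unfolding J_def evl_mean by (simp add: evl_scale right_diff_distrib)
qed

lemma J_diff: "x \<in> space MX \<Longrightarrow> J (f - g) x = J f x - J g x"
  using J_add[of x f "(-1) *\<^sub>R g"] J_scale[of x "-1" g] by simp

lemma L2_norm_cong_space:
  assumes "\<And>x. x \<in> space MX \<Longrightarrow> f x = g x"
  shows "L2_norm P f = L2_norm P g"
  unfolding L2_norm_def L2_inner_def
  by (rule arg_cong[where f = sqrt], rule Bochner_Integration.integral_cong) (auto simp: assms)

lemma J_bounded: "\<exists>K\<ge>0. \<forall>h. L2_norm P (J h) \<le> K * norm h"
proof -
  obtain C where C: "C > 0" "\<And>f. variance (\<lambda>w. evl f (X w)) \<le> C * (norm f)\<^sup>2"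
    using var_bound by blast
  have "L2_norm P (J h) \<le> sqrt C * norm h" for h
  proof (rule power2_le_imp_le)
    have "(L2_norm P (J h))\<^sup>2 = (L2_norm M (\<lambda>w. J h (X w)))\<^sup>2"
      by (simp add: L2_norm_distr[OF X J_sq])
    also have "\<dots> = variance (\<lambda>w. evl h (X w))" unfolding L2_norm_power2 J_def by simp
    also have "\<dots> \<le> (sqrt C * norm h)\<^sup>2" using C by (simp add: power_mult_distrib)
    finally show "(L2_norm P (J h))\<^sup>2 \<le> (sqrt C * norm h)\<^sup>2" .
  qed (use C in simp)
  then show ?thesis using C(1) by (intro exI[of _ "sqrt C"]) auto
qed

text \<open>
  The constants in the definition of density have to be the negative means, because the approximating
  functions have mean zero.
\<close>
lemma J_dense:
  assumes f: "f \<in> L2 P" and e: "e > 0"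
  shows "\<exists>h. L2_norm P (\<lambda>x. f x - J h x) < e"
proof -
  obtain F c where F: "\<And>n::nat. F n \<in> range evl" "\<And>n. (\<lambda>x. F n x + c n) \<in> L2 P"
    and lim: "(\<lambda>n. L2_norm P (\<lambda>x. (F n x + c n) - f x)) \<longlonglongrightarrow> 0"
    using dense f unfolding dense_L2_mod_const_def by blast
  obtain n where n: "L2_norm P (\<lambda>x. (F n x + c n) - f x) < e"
    using order_tendstoD(2)[OF lim e] by (auto simp: eventually_sequentially)
  obtain h where h: "F n = evl h" using F(1) by blast
  have "(\<integral>x. evl h x \<partial>P) + c n = 0"
    using F(2)[of n] evl_integrable[of h] P.prob_space unfolding L2_iff h by simp
  then have "F n x + c n = J h x" for x unfolding J_def evl_mean h by simp
  then show ?thesis using n L2_norm_minus_commute[of P "J h" f] by auto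
qed

end

lemma cov_op_spec:
  assumes "covariance_setting M MX X evX" "covariance_setting M MY Y evY"
    and A: "subspace A" and B: "subspace B" "closed B"
  shows "bounded_op_on A B (cov_op M X evX A Y evY B)"
    and "\<And>f g. g \<in> A \<Longrightarrow> f \<in> B \<Longrightarrow> inner f (cov_op M X evX A Y evY B g)
           = pairing M Y X (covariance_setting.J M Y evY f) (covariance_setting.J M X evX g)"
proof -
  interpret X: covariance_setting M MX X evX by fact
  interpret Y: covariance_setting M MY Y evY by fact
  note pairing_add_left' = pairing_add_left[OF X.X Y.X Y.J_sq Y.J_sq X.J_sq]
    and pairing_add_right' = pairing_add_left[OF Y.X X.X X.J_sq X.J_sq Y.J_sq]
  let ?b = "\<lambda>f g. pairing M Y X (Y.J f) (X.J g)"
  obtain K where K: "K \<ge> 0" "\<And>h. L2_norm X.P (X.J h) \<le> K * norm h" using X.J_bounded by blast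
  obtain L where L: "L \<ge> 0" "\<And>h. L2_norm Y.P (Y.J h) \<le> L * norm h" using Y.J_bounded by blast
  have "\<exists>T. bounded_op_on A B T \<and> (\<forall>g\<in>A. \<forall>f\<in>B. inner f (T g) = ?b f g)"
  proof (rule bounded_form_operator[OF A B, where K = "L * K"])
    show "?b (f + f') g = ?b f g + ?b f' g" for f f' g
      unfolding pairing_add_left'[symmetric] by (rule pairing_cong[OF X.X Y.X]) (auto simp: Y.J_add)
    show "?b (c *\<^sub>R f) g = c * ?b f g" for c f g
      unfolding pairing_scale_left[symmetric] by (rule pairing_cong[OF X.X Y.X]) (auto simp: Y.J_scale)
    show "?b f (g + g') = ?b f g + ?b f g'" for f g g'
      unfolding pairing_commute[of M Y X] pairing_add_right'[symmetric]
      by (rule pairing_cong[OF Y.X X.X]) (auto simp: X.J_add)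
    show "?b f (c *\<^sub>R g) = c * ?b f g" for c f g
      unfolding pairing_commute[of M Y X] pairing_scale_left[symmetric]
      by (rule pairing_cong[OF Y.X X.X]) (auto simp: X.J_scale)
    show "\<bar>?b f g\<bar> \<le> L * K * norm f * norm g" for f g
    proof -
      have "\<bar>?b f g\<bar> \<le> L2_norm Y.P (Y.J f) * L2_norm X.P (X.J g)"
        by (rule pairing_bound[OF X.X Y.X Y.J_sq X.J_sq])
      also have "\<dots> \<le> (L * norm f) * (K * norm g)"
        using K L by (intro mult_mono) (auto simp: L2_norm_nonneg)
      finally show ?thesis by (simp add: algebra_simps)
    qed
  qed
  moreover have "?b f g = covariance M (\<lambda>w. evY f (Y w)) (\<lambda>w. evX g (X w))" for f g
    unfolding pairing_def covariance_def X.J_def Y.J_def ..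
  ultimately have *: "\<exists>T. bounded_op_on A B T \<and>
     (\<forall>g\<in>A. \<forall>f\<in>B. inner f (T g) = covariance M (\<lambda>w. evY f (Y w)) (\<lambda>w. evX g (X w)))" by simp
  show "bounded_op_on A B (cov_op M X evX A Y evY B)"
    using someI_ex[OF *] unfolding cov_op_def by blast
  show "inner f (cov_op M X evX A Y evY B g) = ?b f g" if "g \<in> A" "f \<in> B" for f g
    using someI_ex[OF *] that \<open>\<And>f g. ?b f g = _ f g\<close> unfolding cov_op_def by simp
qed

context covariance_setting
begin

abbreviation "G \<equiv> G_space M X evl"
abbreviation "S \<equiv> Sigma_sqrt M X evl"

lemma setting: "covariance_setting M MX X evl" by unfold_locales

lemma M_op_bounded: "bounded_op_on UNIV UNIV (M_op M X evl)"
  and M_op_inner: "inner f (M_op M X evl g) = L2_inner P (J f) (J g)"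
proof -
  show "bounded_op_on UNIV UNIV (M_op M X evl)"
    unfolding M_op_def by (rule cov_op_spec[OF setting setting]) auto
  show "inner f (M_op M X evl g) = L2_inner P (J f) (J g)"
    unfolding M_op_def pairing_self[OF X J_sq J_sq, symmetric]
    by (rule cov_op_spec[OF setting setting]) auto
qed

lemma G_subspace: "subspace G"
  unfolding G_space_def
  by (rule subspace_closure_of_subspace[OF bounded_op_on_image_subspace[OF M_op_bounded]]) simp

lemma G_closed: "closed G"
  unfolding G_space_def by simp

lemma M_op_in_G: "M_op M X evl h \<in> G"
  unfolding G_space_def by (rule subsetD[OF closure_subset rangeI])

text \<open>
  Projecting onto \<open>G\<close> does not change the centred function: if \<open>r\<close> is orthogonal to \<open>G\<close>, hence to
  \<open>M\<^sub>X\<^sub>X r\<close>, then \<open>\<parallel>J r\<parallel>\<^sup>2 = \<langle>r, M\<^sub>X\<^sub>X r\<rangle> = 0\<close>.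
\<close>
lemma J_dense_G:
  assumes f: "f \<in> L2 P" and e: "e > 0"
  shows "\<exists>h\<in>G. L2_norm P (\<lambda>x. f x - J h x) < e"
proof -
  obtain h where h: "L2_norm P (\<lambda>x. f x - J h x) < e" using J_dense[OF f e] by blast
  obtain p where p: "p \<in> G" "\<And>f. f \<in> G \<Longrightarrow> inner f (h - p) = 0"
    using orthogonal_projection_exists[OF G_subspace G_closed, of h] by blast
  have "(L2_norm P (J (h - p)))\<^sup>2 = 0"
    using p(2)[OF M_op_in_G[of "h - p"]]
    unfolding inner_commute[of "M_op M X evl (h - p)"] M_op_inner L2_inner_self .
  then have zero: "L2_norm P (\<lambda>x. J h x - J p x) = 0"
    using L2_norm_cong_space[of "J (h - p)" "\<lambda>x. J h x - J p x"] by (simp add: J_diff)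
  have "L2_norm P (\<lambda>x. f x - J p x) < e"
    using L2_norm_triangle_diff[OF L2_square_integrable[OF f] J_sq[of h] J_sq[of p]] h zero by simp
  then show ?thesis using p(1) by blast
qed

text \<open>
  An element whose function is almost surely constant is orthogonal to the range of \<open>M\<^sub>X\<^sub>X\<close>, hence to its closure \<open>G\<close>.
\<close>
lemma J_inj_on_G:
  assumes h: "h \<in> G" and zero: "L2_norm P (J h) = 0"
  shows "h = 0"
proof -
  have "inner h (M_op M X evl f) = 0" for f
    using L2_Cauchy_Schwarz[OF J_sq[of h] J_sq[of f]] zero by (simp add: M_op_inner)
  then have "range (M_op M X evl) \<subseteq> {x. inner h x = 0}" by blast
  then have "closure (range (M_op M X evl)) \<subseteq> {x. inner h x = 0}"
    by (rule closure_minimal) (intro closed_Collect_eq continuous_intros)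
  then show ?thesis using h unfolding G_space_def by auto
qed

lemma Sigma_sqrt_spec:
  shows S_bounded: "bounded_op_on G G S"
    and S_sym: "\<And>f g. f \<in> G \<Longrightarrow> g \<in> G \<Longrightarrow> inner f (S g) = inner (S f) g"
    and S_S: "\<And>f. f \<in> G \<Longrightarrow> S (S f) = Sigma_op M X evl X evl f"
proof -
  let ?\<Sigma> = "Sigma_op M X evl X evl"
  have bdd: "bounded_op_on G G ?\<Sigma>"
    unfolding Sigma_op_def by (rule cov_op_spec[OF setting setting G_subspace G_subspace G_closed])
  have inner: "inner f (?\<Sigma> g) = L2_inner P (J f) (J g)" if "f \<in> G" "g \<in> G" for f g
    unfolding Sigma_op_def cov_op_spec(2)[OF setting setting G_subspace G_subspace G_closed that(2,1)]
    by (rule pairing_self[OF X J_sq J_sq])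
  have *: "\<exists>T. bounded_op_on G G T \<and> (\<forall>f\<in>G. \<forall>g\<in>G. inner f (T g) = inner (T f) g) \<and>
     (\<forall>f\<in>G. inner f (T f) \<ge> 0) \<and> (\<forall>f\<in>G. T (T f) = ?\<Sigma> f)"
  proof (rule positive_sqrt_exists[OF G_subspace G_closed bdd])
    fix f g assume fg: "f \<in> G" "g \<in> G"
    show "inner f (?\<Sigma> g) = inner (?\<Sigma> f) g"
      unfolding inner[OF fg] inner_commute[of "?\<Sigma> f" g] inner[OF fg(2,1)] by (rule L2_inner_commute)
  next
    fix f assume "f \<in> G"
    then show "inner f (?\<Sigma> f) \<ge> 0" by (simp add: inner L2_inner_self)
  qed
  note spec = someI_ex[OF *, folded pos_sqrt_on_def Sigma_sqrt_def]
  show "bounded_op_on G G S" "\<And>f g. f \<in> G \<Longrightarrow> g \<in> G \<Longrightarrow> inner f (S g) = inner (S f) g"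
    "\<And>f. f \<in> G \<Longrightarrow> S (S f) = ?\<Sigma> f"
    using spec by blast+
qed

lemma S_in_G: "h \<in> G \<Longrightarrow> S h \<in> G"
  and S_add: "f \<in> G \<Longrightarrow> g \<in> G \<Longrightarrow> S (f + g) = S f + S g"
  and S_scale: "f \<in> G \<Longrightarrow> S (c *\<^sub>R f) = c *\<^sub>R S f"
  using S_bounded unfolding bounded_op_on_def by blast+

lemma S_diff: "f \<in> G \<Longrightarrow> g \<in> G \<Longrightarrow> S (f - g) = S f - S g"
  using S_add[of "f - g" g] subspace_diff[OF G_subspace, of f g] by simp

text \<open>
  \<open>\<parallel>S h\<parallel>\<^sup>2 = \<langle>h, S S h\<rangle>\<close> is the variance of \<open>h(X)\<close>. This makes \<open>J h \<mapsto> S h\<close> a well-defined isometry.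
\<close>
lemma S_norm:
  assumes h: "h \<in> G" shows "norm (S h) = L2_norm P (J h)"
proof (rule power2_eq_imp_eq)
  have "(norm (S h))\<^sup>2 = inner h (S (S h))"
    unfolding power2_norm_eq_inner using S_sym[OF h S_in_G[OF h]] by simp
  also have "\<dots> = L2_inner P (J h) (J h)"
    unfolding S_S[OF h] Sigma_op_def cov_op_spec(2)[OF setting setting G_subspace G_subspace G_closed h h]
    by (rule pairing_self[OF X J_sq J_sq])
  finally show "(norm (S h))\<^sup>2 = (L2_norm P (J h))\<^sup>2" by (simp add: L2_inner_self)
qed (auto simp: L2_norm_nonneg)

lemma S_norm_diff:
  assumes "h \<in> G" "k \<in> G"
  shows "norm (S h - S k) = L2_norm P (\<lambda>x. J h x - J k x)"
  using S_norm[OF subspace_diff[OF G_subspace assms]] L2_norm_cong_space[of "J (h - k)" "\<lambda>x. J h x - J k x"]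
  by (simp add: S_diff[OF assms] J_diff)

text \<open>
  A vector of \<open>G\<close> orthogonal to the range of the symmetric operator \<open>S\<close> lies in its kernel, which is
  trivial.
\<close>
lemma S_range_dense:
  assumes u: "u \<in> G" and e: "e > 0"
  shows "\<exists>h\<in>G. norm (u - S h) < e"
proof -
  let ?C = "closure (S ` G)"
  have C: "subspace ?C"
    by (rule subspace_closure_of_subspace[OF bounded_op_on_image_subspace[OF S_bounded G_subspace]])
  have CG: "?C \<subseteq> G" by (rule closure_minimal[OF _ G_closed]) (auto simp: S_in_G)
  obtain p where p: "p \<in> ?C" "\<And>f. f \<in> ?C \<Longrightarrow> inner f (u - p) = 0"
    using orthogonal_projection_exists[OF C, of u] by auto
  have r: "u - p \<in> G" using u p(1) CG subspace_diff[OF G_subspace] by blast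
  have "S (S (u - p)) \<in> ?C" by (intro subsetD[OF closure_subset] imageI S_in_G r)
  from p(2)[OF this] have "(norm (S (u - p)))\<^sup>2 = 0"
    using S_sym[OF r S_in_G[OF r]] by (simp add: power2_norm_eq_inner inner_commute)
  then have "L2_norm P (J (u - p)) = 0" using S_norm[OF r] by simp
  then have "u = p" using J_inj_on_G[OF r] by simp
  then obtain v where "v \<in> S ` G" "dist v u < e" using p(1) e closure_approachable by blast
  then show ?thesis by (auto simp: dist_norm norm_minus_commute)
qed

section \<open>The isometry between mean-zero functions and the function space\<close>

lemma J_zero_sq: "L2_norm P (\<lambda>x. f x - J 0 x) = L2_norm P f"
  using J_scale[of _ 0 0] by (intro L2_norm_cong_space) simp

lemma S_zero: "S 0 = 0"
  using S_scale[OF subspace_0[OF G_subspace], of 0] by simp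

text \<open>
  The image of \<open>f\<close> under the extended isometry is characterised by its distances to the
  points \<open>S h\<close>. It is the limit of \<open>S h\<^sub>n\<close> for any \<open>h\<^sub>n\<close> with \<open>J h\<^sub>n \<longlonglongrightarrow> f\<close>.
\<close>
lemma isometry_point_exists:
  assumes f: "f \<in> L2 P"
  shows "\<exists>u\<in>G. \<forall>h\<in>G. norm (u - S h) = L2_norm P (\<lambda>x. f x - J h x)"
proof -
  note f_sq = L2_square_integrable[OF f]
  have "\<exists>h\<in>G. L2_norm P (\<lambda>x. f x - J h x) < inverse (real (Suc n))" for n
    by (rule J_dense_G[OF f]) simp
  then obtain h where h: "\<And>n. h n \<in> G" "\<And>n. L2_norm P (\<lambda>x. f x - J (h n) x) < inverse (real (Suc n))"
    by metis
  have "(\<lambda>n. L2_norm P (\<lambda>x. f x - J (h n) x)) \<longlonglongrightarrow> 0"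
    by (rule Lim_null_comparison[OF _ LIMSEQ_inverse_real_of_nat])
       (use h(2) in \<open>auto intro!: always_eventually less_imp_le simp: L2_norm_nonneg\<close>)
  note lim0 = this
  have "Cauchy (\<lambda>n. S (h n))"
  proof (rule metric_CauchyI)
    fix e :: real assume e: "e > 0"
    obtain N where N: "\<And>n. n \<ge> N \<Longrightarrow> L2_norm P (\<lambda>x. f x - J (h n) x) < e / 2"
      using order_tendstoD(2)[OF lim0, of "e / 2"] e by (auto simp: eventually_sequentially)
    show "\<exists>N. \<forall>m\<ge>N. \<forall>n\<ge>N. dist (S (h m)) (S (h n)) < e"
    proof (intro exI[of _ N] allI impI)
      fix m n assume mn: "m \<ge> N" "n \<ge> N"
      have "dist (S (h m)) (S (h n)) = L2_norm P (\<lambda>x. J (h m) x - J (h n) x)"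
        by (simp add: dist_norm S_norm_diff h)
      also have "\<dots> \<le> L2_norm P (\<lambda>x. J (h m) x - f x) + L2_norm P (\<lambda>x. f x - J (h n) x)"
        by (rule L2_norm_triangle_diff[OF J_sq f_sq J_sq])
      also have "\<dots> < e"
        using N[OF mn(1)] N[OF mn(2)] L2_norm_minus_commute[of P f "J (h m)"] by simp
      finally show "dist (S (h m)) (S (h n)) < e" .
    qed
  qed
  then obtain u where u: "(\<lambda>n. S (h n)) \<longlonglongrightarrow> u" using Cauchy_convergent convergent_def by blast
  have uG: "u \<in> G" by (rule closed_sequentially[OF G_closed S_in_G[OF h(1)] u])
  have "norm (u - S k) = L2_norm P (\<lambda>x. f x - J k x)" if k: "k \<in> G" for k
  proof (rule LIMSEQ_unique)
    show "(\<lambda>n. norm (S (h n) - S k)) \<longlonglongrightarrow> norm (u - S k)" by (intro tendsto_intros u)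
    have "(\<lambda>n. norm (S (h n) - S k) - L2_norm P (\<lambda>x. f x - J k x)) \<longlonglongrightarrow> 0"
    proof (rule Lim_null_comparison[OF always_eventually lim0], intro allI)
      fix n
      have "L2_norm P (\<lambda>x. J (h n) x - J k x) \<le> L2_norm P (\<lambda>x. J (h n) x - f x) + L2_norm P (\<lambda>x. f x - J k x)"
        by (rule L2_norm_triangle_diff[OF J_sq f_sq J_sq])
      moreover have "L2_norm P (\<lambda>x. f x - J k x) \<le> L2_norm P (\<lambda>x. f x - J (h n) x) + L2_norm P (\<lambda>x. J (h n) x - J k x)"
        by (rule L2_norm_triangle_diff[OF f_sq J_sq J_sq])
      ultimately show "norm (norm (S (h n) - S k) - L2_norm P (\<lambda>x. f x - J k x))
          \<le> L2_norm P (\<lambda>x. f x - J (h n) x)"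
        using L2_norm_minus_commute[of P f "J (h n)"] by (simp add: S_norm_diff[OF h(1) k] abs_le_iff)
    qed
    then show "(\<lambda>n. norm (S (h n) - S k)) \<longlonglongrightarrow> L2_norm P (\<lambda>x. f x - J k x)"
      by (rule LIM_zero_cancel)
  qed
  then show ?thesis using uG by blast
qed

text \<open>
  Linearity of the extension follows by approximation from \<open>J ` G\<close>. It is onto because \<open>S ` G\<close> is dense
  in \<open>G\<close> and \<open>L\<^sub>2\<close> is complete.
\<close>
lemma isometric_extension_exists:
  "\<exists>T. (\<forall>f\<in>L2 P. \<forall>g\<in>L2 P. T (\<lambda>x. f x + g x) = T f + T g) \<and>
     (\<forall>c. \<forall>f\<in>L2 P. T (\<lambda>x. c * f x) = c *\<^sub>R T f) \<and>
     (\<forall>f\<in>L2 P. norm (T f) = L2_norm P f) \<and>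
     T ` L2 P = G \<and>
     (\<forall>f\<in>G. T (J f) = S f)"
proof -
  obtain T where TG: "\<And>f. f \<in> L2 P \<Longrightarrow> T f \<in> G"
    and T: "\<And>f h. f \<in> L2 P \<Longrightarrow> h \<in> G \<Longrightarrow> norm (T f - S h) = L2_norm P (\<lambda>x. f x - J h x)"
    using isometry_point_exists by metis
  have norm_T: "norm (T f) = L2_norm P f" if "f \<in> L2 P" for f
    using T[OF that subspace_0[OF G_subspace]] by (simp add: S_zero J_zero_sq)
  have add: "T (\<lambda>x. f x + g x) = T f + T g" if f: "f \<in> L2 P" and g: "g \<in> L2 P" for f g
  proof -
    have "norm (T (\<lambda>x. f x + g x) - (T f + T g)) \<le> 0 + e" if e: "e > 0" for e
    proof -
      obtain h where h: "h \<in> G" "L2_norm P (\<lambda>x. f x - J h x) < e / 4" using J_dense_G[OF f, of "e / 4"] e by auto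
      obtain k where k: "k \<in> G" "L2_norm P (\<lambda>x. g x - J k x) < e / 4" using J_dense_G[OF g, of "e / 4"] e by auto
      have hk: "h + k \<in> G" using G_subspace h(1) k(1) by (rule subspace_add)
      have "norm (T (\<lambda>x. f x + g x) - S (h + k)) = L2_norm P (\<lambda>x. (f x - J h x) + (g x - J k x))"
        unfolding T[OF P.L2_add[OF f g] hk] by (rule L2_norm_cong_space) (simp add: J_add)
      also have "\<dots> \<le> L2_norm P (\<lambda>x. f x - J h x) + L2_norm P (\<lambda>x. g x - J k x)"
        by (intro L2_norm_triangle square_integrable_diff L2_square_integrable f g J_L2)
      finally have a: "norm (T (\<lambda>x. f x + g x) - S (h + k)) \<le> e / 2" using h k by simp
      have "T (\<lambda>x. f x + g x) - (T f + T g) = (T (\<lambda>x. f x + g x) - S (h + k)) - ((T f - S h) + (T g - S k))"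
        by (simp add: S_add[OF h(1) k(1)])
      also have "norm \<dots> \<le> norm (T (\<lambda>x. f x + g x) - S (h + k)) + (norm (T f - S h) + norm (T g - S k))"
        by (rule order_trans[OF norm_triangle_ineq4 add_left_mono[OF norm_triangle_ineq]])
      also have "\<dots> \<le> e" using a h(2) k(2) by (simp add: T[OF f h(1)] T[OF g k(1)])
      finally show ?thesis by simp
    qed
    then have "norm (T (\<lambda>x. f x + g x) - (T f + T g)) \<le> 0" by (rule field_le_epsilon)
    then show ?thesis by simp
  qed
  have scale: "T (\<lambda>x. c * f x) = c *\<^sub>R T f" if f: "f \<in> L2 P" for c f
  proof -
    have "norm (T (\<lambda>x. c * f x) - c *\<^sub>R T f) \<le> 0 + e" if e: "e > 0" for e
    proof -
      have pos: "e / (2 * (\<bar>c\<bar> + 1)) > 0" using e by simp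
      obtain h where h: "h \<in> G" "L2_norm P (\<lambda>x. f x - J h x) < e / (2 * (\<bar>c\<bar> + 1))"
        using J_dense_G[OF f pos] by auto
      have "\<bar>c\<bar> * L2_norm P (\<lambda>x. f x - J h x) \<le> (\<bar>c\<bar> + 1) * (e / (2 * (\<bar>c\<bar> + 1)))"
        using h(2) by (intro mult_mono) (auto simp: L2_norm_nonneg)
      also have "\<dots> = e / 2" by (simp add: field_simps add_nonneg_eq_0_iff)
      finally have small: "\<bar>c\<bar> * L2_norm P (\<lambda>x. f x - J h x) \<le> e / 2" .
      have ch: "c *\<^sub>R h \<in> G" using G_subspace h(1) by (rule subspace_scale)
      have "norm (T (\<lambda>x. c * f x) - S (c *\<^sub>R h)) = L2_norm P (\<lambda>x. c * (f x - J h x))"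
        unfolding T[OF P.L2_scale[OF f] ch] by (rule L2_norm_cong_space) (simp add: J_scale right_diff_distrib)
      then have a: "norm (T (\<lambda>x. c * f x) - S (c *\<^sub>R h)) \<le> e / 2" using small by (simp add: L2_norm_scale)
      have "T (\<lambda>x. c * f x) - c *\<^sub>R T f = (T (\<lambda>x. c * f x) - S (c *\<^sub>R h)) - c *\<^sub>R (T f - S h)"
        by (simp add: S_scale[OF h(1)] scaleR_diff_right)
      also have "norm \<dots> \<le> norm (T (\<lambda>x. c * f x) - S (c *\<^sub>R h)) + norm (c *\<^sub>R (T f - S h))"
        by (rule norm_triangle_ineq4)
      also have "\<dots> \<le> e" using a small by (simp add: T[OF f h(1)])
      finally show ?thesis by simp
    qed
    then have "norm (T (\<lambda>x. c * f x) - c *\<^sub>R T f) \<le> 0" by (rule field_le_epsilon)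
    then show ?thesis by simp
  qed
  have TJ: "T (J h) = S h" if h: "h \<in> G" for h
    using T[OF J_L2 h, of h] by (simp add: L2_norm_def L2_inner_def)
  have "G \<subseteq> T ` L2 P"
  proof
    fix u assume u: "u \<in> G"
    have "\<exists>h\<in>G. norm (u - S h) < inverse (real (Suc n))" for n
      by (rule S_range_dense[OF u]) simp
    then obtain h where h: "\<And>n. h n \<in> G" "\<And>n. norm (u - S (h n)) < inverse (real (Suc n))"
      by metis
    have "(\<lambda>n. u - S (h n)) \<longlonglongrightarrow> 0"
      by (rule Lim_null_comparison[OF _ LIMSEQ_inverse_real_of_nat])
         (use h(2) in \<open>auto intro!: always_eventually less_imp_le\<close>)
    from tendsto_diff[OF tendsto_const[of u] this] have lim: "(\<lambda>n. S (h n)) \<longlonglongrightarrow> u" by simp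
    have "\<exists>F\<in>L2 P. (\<lambda>n. L2_norm P (\<lambda>x. J (h n) x - F x)) \<longlonglongrightarrow> 0"
    proof (rule P.L2_complete[OF J_L2])
      fix e :: real assume "e > 0"
      then show "\<exists>N. \<forall>m\<ge>N. \<forall>n\<ge>N. L2_norm P (\<lambda>x. J (h m) x - J (h n) x) < e"
        using metric_CauchyD[OF LIMSEQ_imp_Cauchy[OF lim]] by (simp add: dist_norm S_norm_diff h)
    qed
    then obtain F where F: "F \<in> L2 P" "(\<lambda>n. L2_norm P (\<lambda>x. J (h n) x - F x)) \<longlonglongrightarrow> 0" by blast
    have "(\<lambda>n. norm (T F - S (h n))) \<longlonglongrightarrow> 0"
      using F(2) by (simp add: T[OF F(1) h(1)] L2_norm_minus_commute[of P F])
    then have "(\<lambda>n. T F - S (h n)) \<longlonglongrightarrow> 0" by (rule tendsto_norm_zero_cancel)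
    from tendsto_diff[OF tendsto_const[of "T F"] this] have "(\<lambda>n. S (h n)) \<longlonglongrightarrow> T F" by simp
    then have "u = T F" using lim LIMSEQ_unique by blast
    then show "u \<in> T ` L2 P" using F(1) by blast
  qed
  then have "T ` L2 P = G" using TG by blast
  then show ?thesis using add scale norm_T TJ by (intro exI[of _ T]) simp
qed

abbreviation "T \<equiv> Sigma_sqrt_ext M MX X evl"

lemma T_add: "f \<in> L2 P \<Longrightarrow> g \<in> L2 P \<Longrightarrow> T (\<lambda>x. f x + g x) = T f + T g"
  and T_scale: "f \<in> L2 P \<Longrightarrow> T (\<lambda>x. c * f x) = c *\<^sub>R T f"
  and T_norm: "f \<in> L2 P \<Longrightarrow> norm (T f) = L2_norm P f"
  and T_image: "T ` L2 P = G"
  and T_J: "h \<in> G \<Longrightarrow> T (J h) = S h"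
  using someI_ex[OF isometric_extension_exists, unfolded J_def, folded Sigma_sqrt_ext_def]
  unfolding J_def by blast+

lemma T_in_G: "f \<in> L2 P \<Longrightarrow> T f \<in> G"
  using T_image by blast

lemma T_diff: "f \<in> L2 P \<Longrightarrow> g \<in> L2 P \<Longrightarrow> T (\<lambda>x. f x - g x) = T f - T g"
  using T_add[of f "\<lambda>x. (-1) * g x"] T_scale[of g "-1"] P.L2_scale[of g "-1"] by simp

lemma T_inner:
  assumes f: "f \<in> L2 P" and g: "g \<in> L2 P"
  shows "inner (T f) (T g) = L2_inner P f g"
proof -
  have "(norm (T f + T g))\<^sup>2 = (L2_norm P (\<lambda>x. f x + g x))\<^sup>2"
    using T_norm[OF P.L2_add[OF f g]] T_add[OF f g] by simp
  then show ?thesis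
    unfolding L2_norm_add_power2[OF L2_square_integrable[OF f] L2_square_integrable[OF g]]
      T_norm[OF f, symmetric] T_norm[OF g, symmetric]
    by (simp add: power2_norm_eq_inner inner_add_left inner_add_right inner_commute)
qed

text \<open>
  Functions in \<open>L\<^sub>2\<close> represent classes modulo null sets, so \<open>T\<close> is not injective and the inverse chooses
  a representative.
\<close>
abbreviation "T_inv \<equiv> inv_into (L2 P) T"

lemma T_inv_L2: "u \<in> G \<Longrightarrow> T_inv u \<in> L2 P"
  and T_T_inv: "u \<in> G \<Longrightarrow> T (T_inv u) = u"
  using inv_into_into[of u T "L2 P"] f_inv_into_f[of u T "L2 P"] T_image by simp_all

lemma T_eq_imp_L2_dist_zero:
  assumes "f \<in> L2 P" "g \<in> L2 P" "T f = T g"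
  shows "L2_norm P (\<lambda>x. f x - g x) = 0"
  using T_norm[OF P.L2_diff[OF assms(1,2)]] T_diff[OF assms(1,2)] assms(3) by simp

lemma T_surjE:
  assumes "u \<in> G" obtains f where "f \<in> L2 P" "u = T f"
  using assms T_image by (metis imageE)

end

section \<open>The conditional expectation operator and its adjoint\<close>

locale two_covariance_settings =
  X: covariance_setting M MX X evX + Y: covariance_setting M MY Y evY
  for M :: "'w measure" and MX :: "'x measure" and X :: "'w \<Rightarrow> 'x"
    and evX :: "'h::{real_inner, complete_space} \<Rightarrow> 'x \<Rightarrow> real"
    and MY :: "'y measure" and Y :: "'w \<Rightarrow> 'y"
    and evY :: "'k::{real_inner, complete_space} \<Rightarrow> 'y \<Rightarrow> real"
begin

lemma pairing_bound_L2:
  assumes "f \<in> L2 Y.P" "g \<in> L2 X.P"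
  shows "\<bar>pairing M Y X f g\<bar> \<le> L2_norm Y.P f * L2_norm X.P g"
  using assms by (intro pairing_bound[OF X.X Y.X] L2_square_integrable)

lemma pairing_diff_L2:
  assumes "f \<in> L2 Y.P" "f' \<in> L2 Y.P" "g \<in> L2 X.P" "g' \<in> L2 X.P"
  shows "pairing M Y X (\<lambda>y. f y - f' y) g = pairing M Y X f g - pairing M Y X f' g"
    and "pairing M Y X f (\<lambda>x. g x - g' x) = pairing M Y X f g - pairing M Y X f g'"
proof -
  show "pairing M Y X (\<lambda>y. f y - f' y) g = pairing M Y X f g - pairing M Y X f' g"
    using assms by (intro pairing_diff_left[OF X.X Y.X] L2_square_integrable)
  show "pairing M Y X f (\<lambda>x. g x - g' x) = pairing M Y X f g - pairing M Y X f g'"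
    unfolding pairing_commute[of M Y X]
    using assms by (intro pairing_diff_left[OF Y.X X.X] L2_square_integrable)
qed

lemma pairing_add_L2:
  assumes "f \<in> L2 Y.P" "f' \<in> L2 Y.P" "g \<in> L2 X.P" "g' \<in> L2 X.P"
  shows "pairing M Y X (\<lambda>y. f y + f' y) g = pairing M Y X f g + pairing M Y X f' g"
    and "pairing M Y X f (\<lambda>x. g x + g' x) = pairing M Y X f g + pairing M Y X f g'"
proof -
  show "pairing M Y X (\<lambda>y. f y + f' y) g = pairing M Y X f g + pairing M Y X f' g"
    using assms by (intro pairing_add_left[OF X.X Y.X] L2_square_integrable)
  show "pairing M Y X f (\<lambda>x. g x + g' x) = pairing M Y X f g + pairing M Y X f g'"
    unfolding pairing_commute[of M Y X]
    using assms by (intro pairing_add_left[OF Y.X X.X] L2_square_integrable)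
qed

lemma pairing_scale:
  "pairing M Y X (\<lambda>y. c * f y) g = c * pairing M Y X f g"
  "pairing M Y X f (\<lambda>x. c * g x) = c * pairing M Y X f g"
  using pairing_scale_left[of M Y X c f g] pairing_scale_left[of M X Y c g f]
  by (simp_all add: pairing_commute[of M Y X])

text \<open>
  The chosen representatives are almost surely equal to the given functions, so they have the same pairing.
\<close>
lemma pairing_T_inv:
  assumes f: "f \<in> L2 Y.P" and g: "g \<in> L2 X.P"
  shows "pairing M Y X (Y.T_inv (Y.T f)) (X.T_inv (X.T g)) = pairing M Y X f g"
proof -
  let ?f = "Y.T_inv (Y.T f)" and ?g = "X.T_inv (X.T g)"
  have f': "?f \<in> L2 Y.P" by (rule Y.T_inv_L2[OF Y.T_in_G[OF f]])
  have g': "?g \<in> L2 X.P" by (rule X.T_inv_L2[OF X.T_in_G[OF g]])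
  have "L2_norm Y.P (\<lambda>y. ?f y - f y) = 0"
    by (rule Y.T_eq_imp_L2_dist_zero[OF f' f Y.T_T_inv[OF Y.T_in_G[OF f]]])
  then have 1: "pairing M Y X (\<lambda>y. ?f y - f y) ?g = 0"
    using pairing_bound_L2[OF Y.P.L2_diff[OF f' f] g'] by simp
  have "L2_norm X.P (\<lambda>x. ?g x - g x) = 0"
    by (rule X.T_eq_imp_L2_dist_zero[OF g' g X.T_T_inv[OF X.T_in_G[OF g]]])
  then have 2: "pairing M Y X f (\<lambda>x. ?g x - g x) = 0"
    using pairing_bound_L2[OF f X.P.L2_diff[OF g' g]] by simp
  show ?thesis
    using 1 2 pairing_diff_L2[OF f' f g' g] pairing_diff_L2[OF f f' g' g] by linarith
qed

text \<open>
  The pairing, carried over to \<open>G\<^sub>Y \<times> G\<^sub>X\<close> by the two isometries, is a bilinear form of norm at most 1.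
\<close>
lemma pairing_operator_exists:
  "\<exists>R. bounded_op_on X.G Y.G R \<and>
     (\<forall>g\<in>L2 X.P. \<forall>f\<in>L2 Y.P. inner (Y.T f) (R (X.T g)) = pairing M Y X f g)"
proof -
  let ?b = "\<lambda>v u. pairing M Y X (Y.T_inv v) (X.T_inv u)"
  have b: "?b (Y.T f) (X.T g) = pairing M Y X f g" if "f \<in> L2 Y.P" "g \<in> L2 X.P" for f g
    using pairing_T_inv[OF that] .
  have "\<exists>R. bounded_op_on X.G Y.G R \<and> (\<forall>u\<in>X.G. \<forall>v\<in>Y.G. inner v (R u) = ?b v u)"
  proof (rule bounded_form_operator[OF X.G_subspace Y.G_subspace Y.G_closed, where K = 1])
    fix v v' u assume uv: "v \<in> Y.G" "v' \<in> Y.G" "u \<in> X.G"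
    obtain f where f: "f \<in> L2 Y.P" "v = Y.T f" using uv(1) by (rule Y.T_surjE)
    obtain f' where f': "f' \<in> L2 Y.P" "v' = Y.T f'" using uv(2) by (rule Y.T_surjE)
    obtain g where g: "g \<in> L2 X.P" "u = X.T g" using uv(3) by (rule X.T_surjE)
    show "?b (v + v') u = ?b v u + ?b v' u"
      unfolding f(2) f'(2) g(2) Y.T_add[OF f(1) f'(1), symmetric]
        b[OF f(1) g(1)] b[OF f'(1) g(1)] b[OF Y.P.L2_add[OF f(1) f'(1)] g(1)]
      by (rule pairing_add_L2(1)[OF f(1) f'(1) g(1) g(1)])
  next
    fix c v u assume uv: "v \<in> Y.G" "u \<in> X.G"
    obtain f where f: "f \<in> L2 Y.P" "v = Y.T f" using uv(1) by (rule Y.T_surjE)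
    obtain g where g: "g \<in> L2 X.P" "u = X.T g" using uv(2) by (rule X.T_surjE)
    show "?b (c *\<^sub>R v) u = c * ?b v u"
      unfolding f(2) g(2) Y.T_scale[OF f(1), symmetric] b[OF f(1) g(1)] b[OF Y.P.L2_scale[OF f(1)] g(1)]
      by (rule pairing_scale)
    show "?b v (c *\<^sub>R u) = c * ?b v u"
      unfolding f(2) g(2) X.T_scale[OF g(1), symmetric] b[OF f(1) g(1)] b[OF f(1) X.P.L2_scale[OF g(1)]]
      by (rule pairing_scale)
    show "\<bar>?b v u\<bar> \<le> 1 * norm v * norm u"
      unfolding f(2) g(2) b[OF f(1) g(1)] Y.T_norm[OF f(1)] X.T_norm[OF g(1)]
      using pairing_bound_L2[OF f(1) g(1)] by simp
  next
    fix v u u' assume uv: "v \<in> Y.G" "u \<in> X.G" "u' \<in> X.G"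
    obtain f where f: "f \<in> L2 Y.P" "v = Y.T f" using uv(1) by (rule Y.T_surjE)
    obtain g where g: "g \<in> L2 X.P" "u = X.T g" using uv(2) by (rule X.T_surjE)
    obtain g' where g': "g' \<in> L2 X.P" "u' = X.T g'" using uv(3) by (rule X.T_surjE)
    show "?b v (u + u') = ?b v u + ?b v u'"
      unfolding f(2) g(2) g'(2) X.T_add[OF g(1) g'(1), symmetric]
        b[OF f(1) g(1)] b[OF f(1) g'(1)] b[OF f(1) X.P.L2_add[OF g(1) g'(1)]]
      by (rule pairing_add_L2(2)[OF f(1) f(1) g(1) g'(1)])
  qed
  then obtain R where R: "bounded_op_on X.G Y.G R"
    and inner: "\<And>u v. u \<in> X.G \<Longrightarrow> v \<in> Y.G \<Longrightarrow> inner v (R u) = ?b v u" by blast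
  have "inner (Y.T f) (R (X.T g)) = pairing M Y X f g" if "g \<in> L2 X.P" "f \<in> L2 Y.P" for f g
    using inner[OF X.T_in_G[OF that(1)] Y.T_in_G[OF that(2)]] b[OF that(2,1)] by simp
  then show ?thesis using R by (intro exI[of _ R]) simp
qed

lemma Sigma_YX_inner:
  assumes "h \<in> X.G" "k \<in> Y.G"
  shows "inner k (Sigma_op M X evX Y evY h) = pairing M Y X (Y.J k) (X.J h)"
  unfolding Sigma_op_def
  by (rule cov_op_spec(2)[OF X.setting Y.setting X.G_subspace Y.G_subspace Y.G_closed assms])

lemma Sigma_YX_in_G: "h \<in> X.G \<Longrightarrow> Sigma_op M X evX Y evY h \<in> Y.G"
  using cov_op_spec(1)[OF X.setting Y.setting X.G_subspace Y.G_subspace Y.G_closed]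
  unfolding Sigma_op_def bounded_op_on_def by auto

abbreviation "R \<equiv> R_op M X evX Y evY"

text \<open>
  The operator of the pairing satisfies the factorisation that defines \<open>R\<close>, because \<open>T (J h) = S h\<close>; so
  an operator with that property exists.
\<close>
lemma R_bounded: "bounded_op_on X.G Y.G R"
  and R_factor: "h \<in> X.G \<Longrightarrow> Sigma_op M X evX Y evY h = Y.S (R (X.S h))"
proof -
  obtain R' where bdd: "bounded_op_on X.G Y.G R'"
    and R': "\<And>f g. g \<in> L2 X.P \<Longrightarrow> f \<in> L2 Y.P \<Longrightarrow> inner (Y.T f) (R' (X.T g)) = pairing M Y X f g"
    using pairing_operator_exists by blast
  have R'G: "R' u \<in> Y.G" if "u \<in> X.G" for u
    by (rule bounded_op_on_mem[OF bdd that])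
  have "Sigma_op M X evX Y evY h = Y.S (R' (X.S h))" if h: "h \<in> X.G" for h
  proof (rule subspace_eqI[OF Y.G_subspace Sigma_YX_in_G[OF h] Y.S_in_G[OF R'G[OF X.S_in_G[OF h]]]])
    fix k assume k: "k \<in> Y.G"
    have "inner k (Y.S (R' (X.S h))) = inner (Y.T (Y.J k)) (R' (X.T (X.J h)))"
      unfolding Y.S_sym[OF k R'G[OF X.S_in_G[OF h]]] Y.T_J[OF k] X.T_J[OF h] ..
    also have "\<dots> = pairing M Y X (Y.J k) (X.J h)" by (rule R'[OF X.J_L2 Y.J_L2])
    finally show "inner k (Sigma_op M X evX Y evY h) = inner k (Y.S (R' (X.S h)))"
      by (simp add: Sigma_YX_inner[OF h k])
  qed
  then have *: "\<exists>R. bounded_op_on X.G Y.G R \<and> (\<forall>f\<in>X.G. Sigma_op M X evX Y evY f = Y.S (R (X.S f)))"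
    using bdd by blast
  note spec = someI_ex[OF *, folded R_op_def]
  show "bounded_op_on X.G Y.G R" using spec by (rule conjunct1)
  show "h \<in> X.G \<Longrightarrow> Sigma_op M X evX Y evY h = Y.S (R (X.S h))"
    using conjunct2[OF spec] by (rule bspec)
qed

lemma R_in_G: "u \<in> X.G \<Longrightarrow> R u \<in> Y.G"
  by (rule bounded_op_on_mem[OF R_bounded])

lemma R_diff:
  assumes "u \<in> X.G" "v \<in> X.G" shows "R (u - v) = R u - R v"
proof -
  have "R (u - v + v) = R (u - v) + R v"
    by (rule bounded_op_on_add[OF R_bounded subspace_diff[OF X.G_subspace assms] assms(2)])
  then show ?thesis by simp
qed

text \<open>
  The factorisation of \<open>\<Sigma>\<^sub>Y\<^sub>X\<close> gives the identity for \<open>f = J k\<close> and \<open>g = J h\<close>. Both sides are continuous and such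
  functions are dense, so it extends first to all \<open>g\<close> and then to all \<open>f\<close>.
\<close>
lemma R_pairing:
  assumes f: "f \<in> L2 Y.P" and g: "g \<in> L2 X.P"
  shows "inner (Y.T f) (R (X.T g)) = pairing M Y X f g"
proof -
  define D where "D f g = inner (Y.T f) (R (X.T g)) - pairing M Y X f g" for f g
  obtain K0 where K0: "\<And>u. u \<in> X.G \<Longrightarrow> norm (R u) \<le> K0 * norm u"
    using bounded_op_on_bound[OF R_bounded] by blast
  define K where "K = \<bar>K0\<bar> + 1"
  have D_bound: "\<bar>D f g\<bar> \<le> K * L2_norm Y.P f * L2_norm X.P g"
    if f: "f \<in> L2 Y.P" and g: "g \<in> L2 X.P" for f g
  proof -
    have "\<bar>inner (Y.T f) (R (X.T g))\<bar> \<le> L2_norm Y.P f * norm (R (X.T g))"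
      using Cauchy_Schwarz_ineq2[of "Y.T f" "R (X.T g)"] Y.T_norm[OF f] by simp
    also have "\<dots> \<le> L2_norm Y.P f * (\<bar>K0\<bar> * L2_norm X.P g)"
    proof (intro mult_left_mono)
      have "norm (R (X.T g)) \<le> K0 * L2_norm X.P g" using K0[OF X.T_in_G[OF g]] X.T_norm[OF g] by simp
      also have "\<dots> \<le> \<bar>K0\<bar> * L2_norm X.P g" by (intro mult_right_mono) (auto simp: L2_norm_nonneg)
      finally show "norm (R (X.T g)) \<le> \<bar>K0\<bar> * L2_norm X.P g" .
    qed (simp add: L2_norm_nonneg)
    finally show ?thesis
      using pairing_bound_L2[OF f g] unfolding D_def K_def by (simp add: algebra_simps abs_le_iff)
  qed
  have D_left: "D (\<lambda>y. f y - f' y) g = D f g - D f' g"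
    if "f \<in> L2 Y.P" "f' \<in> L2 Y.P" "g \<in> L2 X.P" for f f' g
    unfolding D_def Y.T_diff[OF that(1,2)] pairing_diff_L2(1)[OF that that(3)] by (simp add: inner_diff_left)
  have D_right: "D f (\<lambda>x. g x - g' x) = D f g - D f g'"
    if "f \<in> L2 Y.P" "g \<in> L2 X.P" "g' \<in> L2 X.P" for f g g'
    unfolding D_def X.T_diff[OF that(2,3)] pairing_diff_L2(2)[OF that(1) that(1) that(2,3)]
      R_diff[OF X.T_in_G[OF that(2)] X.T_in_G[OF that(3)]] by (simp add: inner_diff_right)
  have D_J: "D (Y.J k) (X.J h) = 0" if k: "k \<in> Y.G" and h: "h \<in> X.G" for k h
  proof -
    have "inner (Y.T (Y.J k)) (R (X.T (X.J h))) = inner k (Y.S (R (X.S h)))"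
      unfolding Y.S_sym[OF k R_in_G[OF X.S_in_G[OF h]]] Y.T_J[OF k] X.T_J[OF h] ..
    then show ?thesis unfolding D_def R_factor[OF h, symmetric] Sigma_YX_inner[OF h k] by simp
  qed
  \<comment> \<open>\<open>d\<close> is the defect \<open>D f g\<close>, \<open>s\<close> the distance to an approximating \<open>J h\<close>, and \<open>C\<close> depends on neither\<close>
  have zero_of_small: "d = 0" if "\<And>e. e > 0 \<Longrightarrow> \<exists>s\<ge>0. s < e \<and> \<bar>d\<bar> \<le> C * s" for C d :: real
  proof (rule ccontr)
    assume d: "d \<noteq> 0"
    have "\<bar>d\<bar> / (\<bar>C\<bar> + 1) > 0" using d by simp
    from that[OF this] obtain s where s: "s \<ge> 0" "s < \<bar>d\<bar> / (\<bar>C\<bar> + 1)" "\<bar>d\<bar> \<le> C * s" by blast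
    have "C * s \<le> (\<bar>C\<bar> + 1) * s" using s(1) by (intro mult_right_mono) auto
    also have "\<dots> < \<bar>d\<bar>" using s(2) by (simp add: field_simps)
    finally show False using s(3) by simp
  qed
  have D_left_J: "D (Y.J k) g = 0" if k: "k \<in> Y.G" and g: "g \<in> L2 X.P" for k g
  proof (rule zero_of_small)
    fix e :: real assume "e > 0"
    then obtain h where h: "h \<in> X.G" "L2_norm X.P (\<lambda>x. g x - X.J h x) < e"
      using X.J_dense_G[OF g] by blast
    have "\<bar>D (Y.J k) g\<bar> \<le> K * L2_norm Y.P (Y.J k) * L2_norm X.P (\<lambda>x. g x - X.J h x)"
      using D_bound[OF Y.J_L2 X.P.L2_diff[OF g X.J_L2], of k h]
        D_right[OF Y.J_L2 g X.J_L2, of k h] D_J[OF k h(1)] by simp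
    then show "\<exists>s\<ge>0. s < e \<and> \<bar>D (Y.J k) g\<bar> \<le> K * L2_norm Y.P (Y.J k) * s"
      using h(2) L2_norm_nonneg by blast
  qed
  have "D f g = 0"
  proof (rule zero_of_small)
    fix e :: real assume "e > 0"
    then obtain k where k: "k \<in> Y.G" "L2_norm Y.P (\<lambda>y. f y - Y.J k y) < e"
      using Y.J_dense_G[OF f] by blast
    have "\<bar>D f g\<bar> \<le> K * L2_norm X.P g * L2_norm Y.P (\<lambda>y. f y - Y.J k y)"
      using D_bound[OF Y.P.L2_diff[OF f Y.J_L2] g, of k]
        D_left[OF f Y.J_L2 g, of k] D_left_J[OF k(1) g] by (simp add: algebra_simps)
    then show "\<exists>s\<ge>0. s < e \<and> \<bar>D f g\<bar> \<le> K * L2_norm X.P g * s"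
      using k(2) L2_norm_nonneg by blast
  qed
  then show ?thesis unfolding D_def by simp
qed

abbreviation "E \<equiv> cond_exp_op M MX X evX MY Y evY"
abbreviation "E_adj \<equiv> L2_adjoint X.P Y.P E"

lemma E_L2: "g \<in> L2 X.P \<Longrightarrow> E g \<in> L2 Y.P"
  unfolding cond_exp_op_def by (rule Y.T_inv_L2[OF R_in_G[OF X.T_in_G]])

lemma T_E: "g \<in> L2 X.P \<Longrightarrow> Y.T (E g) = R (X.T g)"
  unfolding cond_exp_op_def by (rule Y.T_T_inv[OF R_in_G[OF X.T_in_G]])

text \<open>
  This identifies \<open>E g\<close> up to null sets as the conditional expectation of \<open>g(X)\<close> given \<open>Y\<close>.
\<close>
lemma E_pairing:
  assumes "f \<in> L2 Y.P" "g \<in> L2 X.P"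
  shows "L2_inner Y.P f (E g) = pairing M Y X f g"
  using Y.T_inner[OF assms(1) E_L2[OF assms(2)]] R_pairing[OF assms] T_E[OF assms(2)] by simp

text \<open>
  The adjoint is the conditional expectation operator in the other direction, which comes from the
  same construction with \<open>X\<close> and \<open>Y\<close> exchanged.
\<close>
lemma E_adjoint_exists:
  "\<exists>B. B \<in> L2 Y.P \<rightarrow> L2 X.P \<and> (\<forall>f\<in>L2 X.P. \<forall>g\<in>L2 Y.P. L2_inner Y.P (E f) g = L2_inner X.P f (B g))"
proof -
  interpret flip: two_covariance_settings M MY Y evY MX X evX by unfold_locales
  obtain R' where bdd: "bounded_op_on Y.G X.G R'"
    and R': "\<And>f g. f \<in> L2 X.P \<Longrightarrow> g \<in> L2 Y.P \<Longrightarrow> inner (X.T f) (R' (Y.T g)) = pairing M X Y f g"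
    using flip.pairing_operator_exists by blast
  define B where "B g = X.T_inv (R' (Y.T g))" for g
  have R'G: "R' (Y.T g) \<in> X.G" if "g \<in> L2 Y.P" for g
    by (rule bounded_op_on_mem[OF bdd Y.T_in_G[OF that]])
  have B_L2: "B g \<in> L2 X.P" if "g \<in> L2 Y.P" for g
    unfolding B_def by (rule X.T_inv_L2[OF R'G[OF that]])
  have "L2_inner Y.P (E f) g = L2_inner X.P f (B g)" if f: "f \<in> L2 X.P" and g: "g \<in> L2 Y.P" for f g
  proof -
    have "L2_inner Y.P (E f) g = pairing M X Y f g"
      unfolding L2_inner_commute[of _ "E f"] E_pairing[OF g f] by (rule pairing_commute)
    also have "\<dots> = inner (X.T f) (X.T (B g))"
      unfolding R'[OF f g, symmetric] B_def X.T_T_inv[OF R'G[OF g]] ..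
    also have "\<dots> = L2_inner X.P f (B g)" by (rule X.T_inner[OF f B_L2[OF g]])
    finally show ?thesis .
  qed
  then show ?thesis using B_L2 by (intro exI[of _ B]) auto
qed

lemma E_adj_L2: "g \<in> L2 Y.P \<Longrightarrow> E_adj g \<in> L2 X.P"
  and E_adj_inner: "f \<in> L2 X.P \<Longrightarrow> g \<in> L2 Y.P \<Longrightarrow> L2_inner Y.P (E f) g = L2_inner X.P f (E_adj g)"
  using someI_ex[OF E_adjoint_exists, folded L2_adjoint_def] by blast+

lemma E_adj_pairing:
  assumes "f \<in> L2 X.P" "g \<in> L2 Y.P"
  shows "L2_inner X.P f (E_adj g) = pairing M Y X g f"
  unfolding E_adj_inner[OF assms, symmetric] L2_inner_commute[of _ "E f"]
  by (rule E_pairing[OF assms(2,1)])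

end

section \<open>Conditional independence and the central class\<close>

lemma sets_sigma_field_of:
  assumes "X \<in> measurable M MX"
  shows "sets (sigma_field_of M MX X) = {X -` A \<inter> space M | A. A \<in> sets MX}"
  unfolding sigma_field_of_def
  using measurable_space[OF assms] by (intro sets_vimage_algebra2) auto

lemma space_sigma_field_of: "space (sigma_field_of M MX X) = space M"
  unfolding sigma_field_of_def by simp

lemma sigma_field_of_subalgebra:
  assumes "X \<in> measurable M MX"
  shows "subalgebra M (sigma_field_of M MX X)"
  unfolding subalgebra_def sets_sigma_field_of[OF assms] space_sigma_field_of
  using measurable_sets[OF assms] by auto

lemma measurable_sigma_field_of:
  assumes "X \<in> measurable M MX" "f \<in> measurable MX N"
  shows "(\<lambda>w. f (X w)) \<in> measurable (sigma_field_of M MX X) N"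
proof (rule measurable_compose[OF _ assms(2)])
  show "X \<in> measurable (sigma_field_of M MX X) MX"
    unfolding sigma_field_of_def using measurable_space[OF assms(1)] by (intro measurable_vimage_algebra1) auto
qed

lemma subalgebra_trans: "subalgebra M F \<Longrightarrow> subalgebra F G \<Longrightarrow> subalgebra M G"
  unfolding subalgebra_def by auto

context prob_space
begin

lemma sigma_finite_subalgebra_of_subalgebra:
  assumes "subalgebra M F" shows "sigma_finite_subalgebra M F"
proof -
  interpret finite_measure_subalgebra M F by unfold_locales (rule assms)
  show ?thesis by unfold_locales
qed

lemma set_integral_preimage:
  "(LINT w:(X -` A \<inter> space M)|M. f w) = (\<integral>w. indicator A (X w) * f w \<partial>M)" for f :: "'a \<Rightarrow> real"
  unfolding set_lebesgue_integral_def
  by (rule Bochner_Integration.integral_cong) (auto simp: indicator_def)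

lemma real_cond_exp_L1_contraction:
  assumes F: "subalgebra M F" and f: "integrable M f"
  shows "(\<integral>w. \<bar>real_cond_exp M F f w\<bar> \<partial>M) \<le> (\<integral>w. \<bar>f w\<bar> \<partial>M)"
proof -
  interpret sigma_finite_subalgebra M F by (rule sigma_finite_subalgebra_of_subalgebra[OF F])
  have af: "integrable M (\<lambda>w. \<bar>f w\<bar>)" using f by simp
  have mf: "integrable M (\<lambda>w. (-1) * f w)" using f by simp
  have le: "AE w in M. real_cond_exp M F f w \<le> real_cond_exp M F (\<lambda>w. \<bar>f w\<bar>) w"
    by (rule real_cond_exp_mono[OF _ f af]) simp
  have ge: "AE w in M. real_cond_exp M F (\<lambda>w. (-1) * f w) w \<le> real_cond_exp M F (\<lambda>w. \<bar>f w\<bar>) w"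
    by (rule real_cond_exp_mono[OF _ mf af]) simp
  have "(\<integral>w. \<bar>real_cond_exp M F f w\<bar> \<partial>M) \<le> (\<integral>w. real_cond_exp M F (\<lambda>w. \<bar>f w\<bar>) w \<partial>M)"
  proof (rule integral_mono_AE)
    show "integrable M (\<lambda>w. \<bar>real_cond_exp M F f w\<bar>)" using real_cond_exp_int(1)[OF f] by simp
    show "integrable M (real_cond_exp M F (\<lambda>w. \<bar>f w\<bar>))" using real_cond_exp_int(1)[OF af] .
    show "AE w in M. \<bar>real_cond_exp M F f w\<bar> \<le> real_cond_exp M F (\<lambda>w. \<bar>f w\<bar>) w"
      using le ge real_cond_exp_cmult[OF f, of "-1"] by eventually_elim (simp add: abs_le_iff)
  qed
  also have "\<dots> = (\<integral>w. \<bar>f w\<bar> \<partial>M)" by (rule real_cond_exp_int(2)[OF af])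
  finally show ?thesis .
qed

lemma integrable_mult_bounded_AE:
  fixes f g :: "'a \<Rightarrow> real"
  assumes f: "integrable M f" and g[measurable]: "g \<in> borel_measurable M" and b: "AE w in M. \<bar>g w\<bar> \<le> 1"
  shows "integrable M (\<lambda>w. f w * g w)"
proof (rule Bochner_Integration.integrable_bound[OF f])
  show "(\<lambda>w. f w * g w) \<in> borel_measurable M" using f by measurable
  show "AE w in M. norm (f w * g w) \<le> norm (f w)"
    using b by eventually_elim (simp add: abs_mult mult_left_le)
qed

text \<open>
  Let \<open>c\<close> be the conditional probability of \<open>X \<in> A\<close> given \<open>F\<close>. Conditional independence says that \<open>c\<close> and the indicator
  of \<open>X \<in> A\<close> have the same integral over every event \<open>Y \<in> B\<close>, hence the same conditional expectation
  given \<open>\<sigma>(Y)\<close>. The indicator may therefore be replaced by \<open>c\<close> when it is integrated against \<open>g(Y)\<close>;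
  since \<open>c\<close> is \<open>F\<close>-measurable, the projection onto \<open>F\<close> can then be moved from the indicator to \<open>g(Y)\<close>.
\<close>
lemma cond_indep_integral:
  assumes X[measurable]: "X \<in> measurable M MX" and Y[measurable]: "Y \<in> measurable M MY"
    and F: "subalgebra M F" and ci: "cond_indep M MX X MY Y F"
    and A[measurable]: "A \<in> sets MX" and g[measurable]: "g \<in> borel_measurable MY"
    and gi: "integrable M (\<lambda>w. g (Y w))"
  shows "(\<integral>w. indicator A (X w) * g (Y w) \<partial>M)
    = (\<integral>w. indicator A (X w) * real_cond_exp M F (\<lambda>w. g (Y w)) w \<partial>M)"
proof -
  let ?FY = "sigma_field_of M MY Y"
  have FY: "subalgebra M ?FY" by (rule sigma_field_of_subalgebra[OF Y])
  interpret F: sigma_finite_subalgebra M F by (rule sigma_finite_subalgebra_of_subalgebra[OF F])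
  interpret FY: sigma_finite_subalgebra M ?FY by (rule sigma_finite_subalgebra_of_subalgebra[OF FY])
  define a :: "'a \<Rightarrow> real" where "a = (\<lambda>w. indicator A (X w))"
  have a_meas[measurable]: "a \<in> borel_measurable M" unfolding a_def by measurable
  have a01: "0 \<le> a w" "a w \<le> 1" for w unfolding a_def by (auto simp: indicator_def)
  have ai: "integrable M a" by (rule integrable_const_bound[where B = 1]) (use a01 in auto)
  define c where "c = real_cond_exp M F a"
  have c_F: "c \<in> borel_measurable F" unfolding c_def by simp
  have c_meas[measurable]: "c \<in> borel_measurable M" unfolding c_def by simp
  have ci': "integrable M c" unfolding c_def by (rule F.real_cond_exp_int(1)[OF ai])
  have c_le: "AE w in M. \<bar>c w\<bar> \<le> 1"
    using F.real_cond_exp_ge_c[OF ai, of 0] F.real_cond_exp_le_c[OF ai, of 1] a01 unfolding c_def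
    by (auto elim: eventually_elim2)
  have a_le: "AE w in M. \<bar>a w\<bar> \<le> 1" using a01 by simp
  have on_rectangles: "(\<integral>w. indicator B (Y w) * c w \<partial>M) = (\<integral>w. indicator B (Y w) * a w \<partial>M)"
    if B[measurable]: "B \<in> sets MY" for B
  proof -
    let ?b = "\<lambda>w. indicator B (Y w) :: real"
    have "integrable M (\<lambda>w. c w * ?b w)"
      by (rule integrable_mult_bounded_AE[OF ci']) (auto simp: indicator_def)
    from F.real_cond_exp_intg(2)[OF this c_F]
    have "(\<integral>w. c w * ?b w \<partial>M) = (\<integral>w. c w * real_cond_exp M F ?b w \<partial>M)" by simp
    also have "\<dots> = (\<integral>w. real_cond_exp M F (\<lambda>w. a w * ?b w) w \<partial>M)"
    proof (rule integral_cong_AE)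
      show "AE w in M. c w * real_cond_exp M F ?b w = real_cond_exp M F (\<lambda>w. a w * ?b w) w"
      proof -
        have "AE w in M. real_cond_exp M F (\<lambda>w. a w * ?b w) w = c w * real_cond_exp M F ?b w"
          using ci[unfolded cond_indep_def, rule_format, OF A B] unfolding c_def a_def .
        then show ?thesis by (auto elim!: eventually_mono)
      qed
    qed auto
    also have "\<dots> = (\<integral>w. a w * ?b w \<partial>M)"
      by (rule F.real_cond_exp_int(2), rule integrable_mult_bounded_AE[OF ai]) (auto simp: indicator_def)
    finally show ?thesis by (simp add: mult.commute)
  qed
  have same_cond: "AE w in M. real_cond_exp M ?FY c w = real_cond_exp M ?FY a w"
  proof (rule FY.real_cond_exp_charact)
    fix S assume S: "S \<in> sets ?FY"
    then obtain B where B: "B \<in> sets MY" "S = Y -` B \<inter> space M"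
      unfolding sets_sigma_field_of[OF Y] by blast
    have "(LINT w:S|M. c w) = (LINT w:S|M. a w)"
      unfolding B(2) set_integral_preimage by (rule on_rectangles[OF B(1)])
    also have "\<dots> = (LINT w:S|M. real_cond_exp M ?FY a w)" by (rule FY.real_cond_exp_intA[OF ai S])
    finally show "(LINT w:S|M. c w) = (LINT w:S|M. real_cond_exp M ?FY a w)" .
  qed (use ci' FY.real_cond_exp_int(1)[OF ai] in simp_all)
  have gY: "(\<lambda>w. g (Y w)) \<in> borel_measurable ?FY" by (rule measurable_sigma_field_of[OF Y g])
  let ?e = "real_cond_exp M F (\<lambda>w. g (Y w))"
  have e_int: "integrable M ?e" by (rule F.real_cond_exp_int(1)[OF gi])
  have "(\<integral>w. g (Y w) * a w \<partial>M) = (\<integral>w. g (Y w) * real_cond_exp M ?FY a w \<partial>M)"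
    by (rule FY.real_cond_exp_intg(2)[symmetric, OF integrable_mult_bounded_AE[OF gi a_meas a_le] gY a_meas])
  also have "\<dots> = (\<integral>w. g (Y w) * real_cond_exp M ?FY c w \<partial>M)"
    by (rule integral_cong_AE) (use same_cond in \<open>auto elim!: eventually_mono\<close>)
  also have "\<dots> = (\<integral>w. g (Y w) * c w \<partial>M)"
    by (rule FY.real_cond_exp_intg(2)[OF integrable_mult_bounded_AE[OF gi c_meas c_le] gY c_meas])
  also have "\<dots> = (\<integral>w. c w * g (Y w) \<partial>M)" by (simp add: mult.commute)
  also have "\<dots> = (\<integral>w. c w * ?e w \<partial>M)"
  proof (rule F.real_cond_exp_intg(2)[symmetric, OF _ c_F])
    show "integrable M (\<lambda>w. c w * g (Y w))"
      using integrable_mult_bounded_AE[OF gi c_meas c_le] by (simp add: mult.commute)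
  qed measurable
  also have "\<dots> = (\<integral>w. ?e w * c w \<partial>M)" by (simp add: mult.commute)
  also have "\<dots> = (\<integral>w. ?e w * a w \<partial>M)"
    unfolding c_def by (rule F.real_cond_exp_intg(2)[OF integrable_mult_bounded_AE[OF e_int a_meas a_le]]) auto
  finally show ?thesis unfolding a_def by (simp add: mult.commute)
qed

text \<open>
  A version \<open>k(X)\<close> of the conditional expectation of \<open>g(Y)\<close> given \<open>\<sigma>(X)\<close> is also one given \<open>F\<close>: the
  conditional expectation given \<open>F\<close> is \<open>\<sigma>(X)\<close>-measurable and has the same integrals over the sets of
  \<open>\<sigma>(X)\<close>.
\<close>
lemma AE_eq_cond_exp_of_cond_indep:
  assumes X[measurable]: "X \<in> measurable M MX" and Y[measurable]: "Y \<in> measurable M MY"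
    and F: "subalgebra (sigma_field_of M MX X) F" and ci: "cond_indep M MX X MY Y F"
    and g[measurable]: "g \<in> borel_measurable MY" and gi: "integrable M (\<lambda>w. g (Y w))"
    and k[measurable]: "k \<in> borel_measurable MX" and ki: "integrable M (\<lambda>w. k (X w))"
    and eq: "\<And>A. A \<in> sets MX \<Longrightarrow> (\<integral>w. indicator A (X w) * k (X w) \<partial>M) = (\<integral>w. indicator A (X w) * g (Y w) \<partial>M)"
  shows "AE w in M. k (X w) = real_cond_exp M F (\<lambda>w. g (Y w)) w"
proof -
  let ?FX = "sigma_field_of M MX X" and ?e = "real_cond_exp M F (\<lambda>w. g (Y w))"
  have FX: "subalgebra M ?FX" by (rule sigma_field_of_subalgebra[OF X])
  have F': "subalgebra M F" by (rule subalgebra_trans[OF FX F])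
  interpret FX: sigma_finite_subalgebra M ?FX by (rule sigma_finite_subalgebra_of_subalgebra[OF FX])
  interpret F: sigma_finite_subalgebra M F by (rule sigma_finite_subalgebra_of_subalgebra[OF F'])
  have "AE w in M. real_cond_exp M ?FX (\<lambda>w. k (X w)) w = ?e w"
  proof (rule FX.real_cond_exp_charact[OF _ ki])
    fix S assume "S \<in> sets ?FX"
    then obtain A where A: "A \<in> sets MX" "S = X -` A \<inter> space M"
      unfolding sets_sigma_field_of[OF X] by blast
    show "(LINT w:S|M. k (X w)) = (LINT w:S|M. ?e w)"
      unfolding A(2) set_integral_preimage eq[OF A(1)]
      by (rule cond_indep_integral[OF X Y F' ci A(1) g gi])
  next
    show "integrable M ?e" by (rule F.real_cond_exp_int(1)[OF gi])
    show "?e \<in> borel_measurable ?FX" by (rule measurable_from_subalg[OF F]) simp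
  qed
  moreover have "AE w in M. real_cond_exp M ?FX (\<lambda>w. k (X w)) w = k (X w)"
    by (rule FX.real_cond_exp_F_meas[OF ki measurable_sigma_field_of[OF X k]])
  ultimately show ?thesis by eventually_elim simp
qed

lemma central_class_diff:
  assumes X: "X \<in> measurable M MX"
    and f: "f \<in> central_class M MX X F" and g: "g \<in> central_class M MX X F"
  shows "(\<lambda>x. f x - g x) \<in> central_class M MX X F"
proof -
  interpret P: prob_space "distr M MX X" by (rule prob_space_distr[OF X])
  obtain h k where hk: "h \<in> borel_measurable F" "AE w in M. f (X w) = h w"
    "k \<in> borel_measurable F" "AE w in M. g (X w) = k w"
    using f g unfolding central_class_def by blast
  have "AE w in M. f (X w) - g (X w) = h w - k w" using hk(2,4) by eventually_elim simp
  moreover have "(\<lambda>w. h w - k w) \<in> borel_measurable F" using hk(1,3) by simp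
  ultimately show ?thesis
    using P.L2_diff[of f g] f g unfolding central_class_def
    by (auto intro!: bexI[of _ "\<lambda>w. h w - k w"])
qed

text \<open>
  If \<open>g(X)\<close> is \<open>F\<close>-measurable then \<open>f(X)\<close> minus its conditional expectation given \<open>F\<close> is unchanged when \<open>f\<close> is replaced by
  \<open>f - g\<close>, so its \<open>L\<^sub>1\<close> norm is at most \<open>2 \<parallel>f - g\<parallel>\<close>, which is arbitrarily small.
\<close>
lemma central_class_closed:
  assumes X[measurable]: "X \<in> measurable M MX" and F: "subalgebra M F"
    and A: "A \<subseteq> central_class M MX X F"
  shows "L2_closure (distr M MX X) A \<subseteq> central_class M MX X F"
proof
  let ?P = "distr M MX X"
  interpret P: prob_space ?P by (rule prob_space_distr[OF X])
  interpret F: sigma_finite_subalgebra M F by (rule sigma_finite_subalgebra_of_subalgebra[OF F])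
  fix f assume "f \<in> L2_closure ?P A"
  then have f: "f \<in> L2 ?P" and approx: "\<And>e. e > 0 \<Longrightarrow> \<exists>g\<in>A. L2_norm ?P (\<lambda>x. f x - g x) < e"
    unfolding L2_closure_def by auto
  have int: "integrable M (\<lambda>w. g (X w))" if "g \<in> L2 ?P" for g
    by (rule square_integrable_imp_integrable_self[OF square_integrable_distr[OF X L2_square_integrable[OF that]]])
  define v where "v = real_cond_exp M F (\<lambda>w. f (X w))"
  have v_int: "integrable M v" unfolding v_def by (rule F.real_cond_exp_int(1)[OF int[OF f]])
  have dist_int: "integrable M (\<lambda>w. \<bar>f (X w) - v w\<bar>)" using int[OF f] v_int by simp
  have "(\<integral>w. \<bar>f (X w) - v w\<bar> \<partial>M) \<le> 0 + e" if e: "e > 0" for e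
  proof -
    obtain g where gA: "g \<in> A" and g: "L2_norm ?P (\<lambda>x. f x - g x) < e / 2"
      using approx[of "e / 2"] e by auto
    have gL2: "g \<in> L2 ?P" using gA A unfolding central_class_def by auto
    obtain h where h: "h \<in> borel_measurable F" "AE w in M. g (X w) = h w"
      using gA A unfolding central_class_def by auto
    define d where "d w = f (X w) - g (X w)" for w
    have d_int: "integrable M d" unfolding d_def using int[OF f] int[OF gL2] by simp
    have h_meas: "h \<in> borel_measurable M" by (rule measurable_from_subalg[OF F h(1)])
    have h_int: "integrable M h"
      using int[OF gL2] integrable_cong_AE[OF _ h_meas h(2)] int[OF gL2] by auto
    have "AE w in M. real_cond_exp M F (\<lambda>w. g (X w)) w = real_cond_exp M F h w"
      by (rule F.real_cond_exp_cong[OF h(2)]) (use int[OF gL2] h_meas in auto)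
    moreover have "AE w in M. real_cond_exp M F h w = h w" by (rule F.real_cond_exp_F_meas[OF h_int h(1)])
    moreover have "AE w in M. real_cond_exp M F d w = v w - real_cond_exp M F (\<lambda>w. g (X w)) w"
      unfolding d_def v_def by (rule F.real_cond_exp_diff[OF int[OF f] int[OF gL2]])
    ultimately have "AE w in M. \<bar>f (X w) - v w\<bar> \<le> \<bar>d w\<bar> + \<bar>real_cond_exp M F d w\<bar>"
      using h(2) by eventually_elim (simp add: d_def)
    then have "(\<integral>w. \<bar>f (X w) - v w\<bar> \<partial>M) \<le> (\<integral>w. \<bar>d w\<bar> + \<bar>real_cond_exp M F d w\<bar> \<partial>M)"
      using d_int F.real_cond_exp_int(1)[OF d_int] by (intro integral_mono_AE dist_int) auto
    also have "\<dots> = (\<integral>w. \<bar>d w\<bar> \<partial>M) + (\<integral>w. \<bar>real_cond_exp M F d w\<bar> \<partial>M)"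
      using d_int F.real_cond_exp_int(1)[OF d_int] by simp
    also have "\<dots> \<le> 2 * (\<integral>w. \<bar>d w\<bar> \<partial>M)" using real_cond_exp_L1_contraction[OF F d_int] by simp
    also have "(\<integral>w. \<bar>d w\<bar> \<partial>M) \<le> L2_norm ?P (\<lambda>x. f x - g x)"
    proof -
      have sq: "square_integrable ?P (\<lambda>x. f x - g x)" by (rule L2_square_integrable[OF P.L2_diff[OF f gL2]])
      show ?thesis
        using integral_abs_le_L2_norm[OF square_integrable_distr[OF X sq]]
        unfolding L2_norm_distr[OF X sq] d_def .
    qed
    finally show ?thesis using g by simp
  qed
  then have "(\<integral>w. \<bar>f (X w) - v w\<bar> \<partial>M) \<le> 0" by (rule field_le_epsilon)
  then have "(\<integral>w. \<bar>f (X w) - v w\<bar> \<partial>M) = 0" by (simp add: antisym)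
  then have "AE w in M. \<bar>f (X w) - v w\<bar> = 0"
    using integral_nonneg_eq_0_iff_AE[OF dist_int] by simp
  then have "AE w in M. f (X w) = v w" by (auto elim!: eventually_mono)
  moreover have "v \<in> borel_measurable F" unfolding v_def by simp
  ultimately show "f \<in> central_class M MX X F"
    using f unfolding central_class_def by blast
qed

end

section \<open>The closed range\<close>

context two_covariance_settings
begin

lemma integral_L2_zero:
  assumes "g \<in> L2 Y.P"
  shows "(\<integral>w. g (Y w) \<partial>M) = 0" "integrable M (\<lambda>w. g (Y w))" "g \<in> borel_measurable MY"
proof -
  show m: "g \<in> borel_measurable MY" using assms unfolding L2_def by simp
  show "(\<integral>w. g (Y w) \<partial>M) = 0" using assms m unfolding L2_def by (simp add: integral_distr)
  show "integrable M (\<lambda>w. g (Y w))"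
    using X.square_integrable_imp_integrable_self[OF square_integrable_distr[OF Y.X L2_square_integrable[OF assms]]] .
qed

text \<open>
  Events are tested through their centred indicators; the subtracted constant does not contribute to
  the pairing with a mean-zero function.
\<close>
lemma pairing_indicator:
  assumes g: "g \<in> L2 Y.P" and A: "A \<in> sets MX"
  defines "f \<equiv> (\<lambda>x. indicator A x - (\<integral>x. indicator A x \<partial>X.P))"
  shows "f \<in> L2 X.P" "pairing M Y X g f = (\<integral>w. indicator A (X w) * g (Y w) \<partial>M)"
proof -
  have sq: "square_integrable X.P (indicator A :: _ \<Rightarrow> real)"
    unfolding square_integrable_def using A by (auto intro!: X.P.integrable_const_bound[where B = 1] simp: indicator_def)
  show f: "f \<in> L2 X.P" unfolding f_def by (rule X.P.centered_in_L2[OF sq])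
  let ?c = "\<integral>x. indicator A x \<partial>X.P :: real"
  have i: "integrable M (\<lambda>w. indicator A (X w) * g (Y w))"
    using square_integrable_mult[OF square_integrable_distr[OF X.X sq] square_integrable_distr[OF Y.X L2_square_integrable[OF g]]] .
  have "pairing M Y X g f = (\<integral>w. indicator A (X w) * g (Y w) - ?c * g (Y w) \<partial>M)"
    unfolding pairing_def f_def by (simp add: algebra_simps)
  also have "\<dots> = (\<integral>w. indicator A (X w) * g (Y w) \<partial>M)"
    using i integral_L2_zero[OF g] by simp
  finally show "pairing M Y X g f = (\<integral>w. indicator A (X w) * g (Y w) \<partial>M)" .
qed

lemma E_adj_in_central_class:
  assumes F: "subalgebra (sigma_field_of M MX X) F" and ci: "cond_indep M MX X MY Y F"
    and g: "g \<in> L2 Y.P"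
  shows "E_adj g \<in> central_class M MX X F"
proof -
  interpret XX: two_covariance_settings M MX X evX MX X evX by unfold_locales
  have k: "E_adj g \<in> L2 X.P" by (rule E_adj_L2[OF g])
  have "AE w in M. E_adj g (X w) = real_cond_exp M F (\<lambda>w. g (Y w)) w"
  proof (rule X.AE_eq_cond_exp_of_cond_indep[OF X.X Y.X F ci])
    fix A assume A: "A \<in> sets MX"
    let ?f = "\<lambda>x. indicator A x - (\<integral>x. indicator A x \<partial>X.P) :: real"
    have f: "?f \<in> L2 X.P" by (rule pairing_indicator(1)[OF g A])
    have "(\<integral>w. indicator A (X w) * E_adj g (X w) \<partial>M) = pairing M X X (E_adj g) ?f"
      by (rule XX.pairing_indicator(2)[OF k A, symmetric])
    also have "\<dots> = L2_inner X.P (E_adj g) ?f"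
      by (rule pairing_self[OF X.X L2_square_integrable[OF k] L2_square_integrable[OF f]])
    also have "\<dots> = pairing M Y X g ?f"
      unfolding L2_inner_commute[of _ "E_adj g"] by (rule E_adj_pairing[OF f g])
    also have "\<dots> = (\<integral>w. indicator A (X w) * g (Y w) \<partial>M)" by (rule pairing_indicator(2)[OF g A])
    finally show "(\<integral>w. indicator A (X w) * E_adj g (X w) \<partial>M) = (\<integral>w. indicator A (X w) * g (Y w) \<partial>M)" .
  qed (rule integral_L2_zero[OF g] XX.integral_L2_zero[OF k])+
  then show ?thesis
    unfolding central_class_def using k by (auto intro!: bexI[of _ "real_cond_exp M F (\<lambda>w. g (Y w))"])
qed

lemma cond_exp_zero_of_E_zero:
  assumes r: "r \<in> L2 X.P" and zero: "L2_norm Y.P (E r) = 0"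
  shows "AE w in M. real_cond_exp M (sigma_field_of M MY Y) (\<lambda>w. r (X w)) w = 0"
proof -
  interpret flip: two_covariance_settings M MY Y evY MX X evX by unfold_locales
  interpret FY: sigma_finite_subalgebra M "sigma_field_of M MY Y"
    by (rule X.sigma_finite_subalgebra_of_subalgebra[OF sigma_field_of_subalgebra[OF Y.X]])
  show ?thesis
  proof (rule FY.real_cond_exp_charact)
    fix S assume "S \<in> sets (sigma_field_of M MY Y)"
    then obtain B where B: "B \<in> sets MY" "S = Y -` B \<inter> space M"
      unfolding sets_sigma_field_of[OF Y.X] by blast
    let ?f = "\<lambda>y. indicator B y - (\<integral>y. indicator B y \<partial>Y.P) :: real"
    have f: "?f \<in> L2 Y.P" by (rule flip.pairing_indicator(1)[OF r B(1)])
    have "(\<integral>w. indicator B (Y w) * r (X w) \<partial>M) = pairing M X Y r ?f"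
      by (rule flip.pairing_indicator(2)[OF r B(1), symmetric])
    also have "\<dots> = L2_inner Y.P ?f (E r)"
      unfolding E_pairing[OF f r] by (rule pairing_commute)
    also have "\<dots> = 0"
      using L2_Cauchy_Schwarz[OF L2_square_integrable[OF f] L2_square_integrable[OF E_L2[OF r]]] zero by simp
    finally show "(LINT w:S|M. r (X w)) = (LINT w:S|M. 0)"
      unfolding B(2) X.set_integral_preimage by simp
  qed (use flip.integral_L2_zero[OF r] in simp_all)
qed

lemma T_EE_inner:
  assumes f: "f \<in> L2 X.P" and h: "h \<in> L2 X.P"
  shows "inner (X.T h) (X.T (E_adj (E f))) = inner (R (X.T h)) (R (X.T f))"
  using X.T_inner[OF h E_adj_L2[OF E_L2[OF f]]] E_adj_inner[OF h E_L2[OF f]]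
    Y.T_inner[OF E_L2[OF h] E_L2[OF f]]
  by (simp add: T_E f h)

text \<open>
  Only the class of \<open>E\<^sup>*E f\<close> modulo null sets depends linearly on \<open>f\<close>, so linearity is read off
  after applying the isometry \<open>T\<close>.
\<close>
lemma T_EE_subspace: "subspace ((\<lambda>f. X.T (E_adj (E f))) ` L2 X.P)"
  unfolding subspace_def
proof (intro conjI ballI allI)
  let ?U = "\<lambda>f. X.T (E_adj (E f))"
  have UG: "?U f \<in> X.G" if "f \<in> L2 X.P" for f
    by (rule X.T_in_G[OF E_adj_L2[OF E_L2[OF that]]])
  have add: "?U f + ?U g = ?U (\<lambda>x. f x + g x)" if f: "f \<in> L2 X.P" and g: "g \<in> L2 X.P" for f g
  proof (rule subspace_eqI[OF X.G_subspace subspace_add[OF X.G_subspace UG[OF f] UG[OF g]] UG[OF X.P.L2_add[OF f g]]])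
    fix u assume "u \<in> X.G"
    then obtain h where h: "h \<in> L2 X.P" "u = X.T h" by (rule X.T_surjE)
    show "inner u (?U f + ?U g) = inner u (?U (\<lambda>x. f x + g x))"
      unfolding h(2) inner_add_right T_EE_inner[OF f h(1)] T_EE_inner[OF g h(1)]
        T_EE_inner[OF X.P.L2_add[OF f g] h(1)] X.T_add[OF f g]
        bounded_op_on_add[OF R_bounded X.T_in_G[OF f] X.T_in_G[OF g]] ..
  qed
  have scale: "c *\<^sub>R ?U f = ?U (\<lambda>x. c * f x)" if f: "f \<in> L2 X.P" for c f
  proof (rule subspace_eqI[OF X.G_subspace subspace_scale[OF X.G_subspace UG[OF f]] UG[OF X.P.L2_scale[OF f]]])
    fix u assume "u \<in> X.G"
    then obtain h where h: "h \<in> L2 X.P" "u = X.T h" by (rule X.T_surjE)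
    show "inner u (c *\<^sub>R ?U f) = inner u (?U (\<lambda>x. c * f x))"
      unfolding h(2) inner_scaleR_right T_EE_inner[OF f h(1)]
        T_EE_inner[OF X.P.L2_scale[OF f] h(1)] X.T_scale[OF f]
        bounded_op_on_scale[OF R_bounded X.T_in_G[OF f]] ..
  qed
  have zero_L2: "(\<lambda>x. 0) \<in> L2 X.P" unfolding L2_def by simp
  have "?U (\<lambda>x. 0 * (0::real)) = 0 *\<^sub>R ?U (\<lambda>x. 0)" by (rule scale[OF zero_L2, symmetric])
  then have "?U (\<lambda>x. 0) = 0" by simp
  then show "0 \<in> ?U ` L2 X.P" using zero_L2 by (metis imageI)
  show "u + v \<in> ?U ` L2 X.P" if "u \<in> ?U ` L2 X.P" "v \<in> ?U ` L2 X.P" for u v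
    using that add X.P.L2_add by auto
  show "c *\<^sub>R u \<in> ?U ` L2 X.P" if "u \<in> ?U ` L2 X.P" for c u
    using that scale X.P.L2_scale by auto
qed

text \<open>
  The orthogonal projection takes place in \<open>G\<^sub>X\<close>, where the image of the range of \<open>E\<^sup>*E\<close> is a subspace; the
  residual \<open>r\<close> satisfies \<open>\<parallel>E r\<parallel>\<^sup>2 = \<langle>r, E\<^sup>*E r\<rangle> = 0\<close>.
\<close>
lemma closure_range_residual:
  assumes f: "f \<in> L2 X.P"
  shows "\<exists>p\<in>L2_closure X.P ((\<lambda>f. E_adj (E f)) ` L2 X.P). L2_norm Y.P (E (\<lambda>x. f x - p x)) = 0"
proof -
  let ?U = "\<lambda>f. X.T (E_adj (E f))"
  let ?C = "closure (?U ` L2 X.P)"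
  have UG: "?U g \<in> X.G" if "g \<in> L2 X.P" for g
    by (rule X.T_in_G[OF E_adj_L2[OF E_L2[OF that]]])
  have CG: "?C \<subseteq> X.G" by (rule closure_minimal[OF _ X.G_closed]) (use UG in blast)
  obtain q where q: "q \<in> ?C" "\<And>u. u \<in> ?C \<Longrightarrow> inner u (X.T f - q) = 0"
    using orthogonal_projection_exists[OF subspace_closure_of_subspace[OF T_EE_subspace] closed_closure, of "X.T f"]
    by blast
  have "q \<in> X.G" using q(1) CG by blast
  then obtain p where p: "p \<in> L2 X.P" "q = X.T p" by (rule X.T_surjE)
  have r: "(\<lambda>x. f x - p x) \<in> L2 X.P" by (rule X.P.L2_diff[OF f p(1)])
  have "?U (\<lambda>x. f x - p x) \<in> ?C" by (intro subsetD[OF closure_subset] imageI r)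
  from q(2)[OF this] have "inner (X.T (\<lambda>x. f x - p x)) (?U (\<lambda>x. f x - p x)) = 0"
    unfolding X.T_diff[OF f p(1)] p(2) by (simp only: inner_commute)
  then have "inner (R (X.T (\<lambda>x. f x - p x))) (R (X.T (\<lambda>x. f x - p x))) = 0"
    unfolding T_EE_inner[OF r r] .
  then have "L2_norm Y.P (E (\<lambda>x. f x - p x)) = 0"
    using Y.T_norm[OF E_L2[OF r]] T_E[OF r] by simp
  moreover have "p \<in> L2_closure X.P ((\<lambda>f. E_adj (E f)) ` L2 X.P)"
    unfolding L2_closure_def
  proof (intro CollectI conjI allI impI)
    fix e :: real assume "e > 0"
    then obtain u where "u \<in> ?U ` L2 X.P" "dist u q < e" using q(1) unfolding closure_approachable by blast
    then obtain g where g: "g \<in> L2 X.P" "dist (?U g) q < e" by blast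
    have EE: "E_adj (E g) \<in> L2 X.P" by (rule E_adj_L2[OF E_L2[OF g(1)]])
    have "L2_norm X.P (\<lambda>x. p x - E_adj (E g) x) = dist (?U g) q"
      unfolding X.T_norm[OF X.P.L2_diff[OF p(1) EE], symmetric] X.T_diff[OF p(1) EE] p(2)
      by (simp add: dist_norm norm_minus_commute)
    then have "L2_norm X.P (\<lambda>x. p x - E_adj (E g) x) < e" using g(2) by simp
    then show "\<exists>h\<in>(\<lambda>f. E_adj (E f)) ` L2 X.P. L2_norm X.P (\<lambda>x. p x - h x) < e"
      using g(1) by blast
  qed (rule p(1))
  ultimately show ?thesis by blast
qed

lemma closure_range_eq_central_class:
  assumes F: "subalgebra (sigma_field_of M MX X) F" and ci: "cond_indep M MX X MY Y F"
    and complete: "complete_class M X MY Y (central_class M MX X F)"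
  shows "L2_closure X.P ((\<lambda>f. E_adj (E f)) ` L2 X.P) = central_class M MX X F"
proof
  let ?ran = "(\<lambda>f. E_adj (E f)) ` L2 X.P"
  have F': "subalgebra M F" by (rule subalgebra_trans[OF sigma_field_of_subalgebra[OF X.X] F])
  have "?ran \<subseteq> central_class M MX X F"
    using E_adj_in_central_class[OF F ci] E_L2 by auto
  then show sub: "L2_closure X.P ?ran \<subseteq> central_class M MX X F"
    by (rule X.central_class_closed[OF X.X F'])
  show "central_class M MX X F \<subseteq> L2_closure X.P ?ran"
  proof
    fix f assume f: "f \<in> central_class M MX X F"
    then have fL2: "f \<in> L2 X.P" unfolding central_class_def by simp
    obtain p where p: "p \<in> L2_closure X.P ?ran" "L2_norm Y.P (E (\<lambda>x. f x - p x)) = 0"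
      using closure_range_residual[OF fL2] by blast
    have pL2: "p \<in> L2 X.P" using p(1) unfolding L2_closure_def by simp
    let ?r = "\<lambda>x. f x - p x"
    have r: "?r \<in> L2 X.P" by (rule X.P.L2_diff[OF fL2 pL2])
    have r_central: "?r \<in> central_class M MX X F"
      using X.central_class_diff[OF X.X f] sub p(1) by blast
    have "AE w in M. ?r (X w) = 0"
      using complete[unfolded complete_class_def, rule_format, OF r_central cond_exp_zero_of_E_zero[OF r p(2)]] .
    then have "L2_norm M (\<lambda>w. ?r (X w)) = L2_norm M (\<lambda>w. 0)"
      by (rule L2_norm_cong_AE)
         (use square_integrable_distr[OF X.X L2_square_integrable[OF r]] in \<open>simp_all add: square_integrable_def\<close>)
    then have zero: "L2_norm X.P ?r = 0"
      unfolding L2_norm_distr[OF X.X L2_square_integrable[OF r]] by (simp add: L2_norm_def L2_inner_def)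
    show "f \<in> L2_closure X.P ?ran"
      unfolding L2_closure_def
    proof (intro CollectI conjI allI impI)
      fix e :: real assume "e > 0"
      then obtain g where g: "g \<in> L2 X.P" "L2_norm X.P (\<lambda>x. p x - E_adj (E g) x) < e"
        using p(1) unfolding L2_closure_def by blast
      have "L2_norm X.P (\<lambda>x. f x - E_adj (E g) x) \<le> L2_norm X.P ?r + L2_norm X.P (\<lambda>x. p x - E_adj (E g) x)"
        by (intro L2_norm_triangle_diff L2_square_integrable fL2 pL2 E_adj_L2[OF E_L2[OF g(1)]])
      then have "L2_norm X.P (\<lambda>x. f x - E_adj (E g) x) < e" using g(2) zero by linarith
      then show "\<exists>h\<in>?ran. L2_norm X.P (\<lambda>x. f x - h x) < e" using g(1) by blast
    qed (rule fL2)
  qed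
qed

end

theorem theorem5:
  fixes M :: "'w measure" and MX :: "'x measure" and MY :: "'y measure"
    and X :: "'w \<Rightarrow> 'x" and Y :: "'w \<Rightarrow> 'y"
    and K :: "'y \<Rightarrow> 'x measure"
    and evX :: "'h::{real_inner, complete_space} \<Rightarrow> 'x \<Rightarrow> real"
    and evY :: "'k::{real_inner, complete_space} \<Rightarrow> 'y \<Rightarrow> real"
    and G :: "'w measure"
  assumes "prob_space M"
    and "X \<in> measurable M MX" and "Y \<in> measurable M MY"
    and "regular_cond_distr M MX X MY Y K"
    and "dominated_family MX (K ` space MY)"
    and "function_space_on (space MX) evX"
    and "function_space_on (space MY) evY"
    and A_X: "dense_L2_mod_const (range evX) (distr M MX X)"
    and A_Y: "dense_L2_mod_const (range evY) (distr M MY Y)"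
    and B_X: "\<exists>C>0. \<forall>f. prob_space.variance M (\<lambda>w. evX f (X w)) \<le> C * (norm f)\<^sup>2"
    and B_Y: "\<exists>C>0. \<forall>g. prob_space.variance M (\<lambda>w. evY g (Y w)) \<le> C * (norm g)\<^sup>2"
    and "central_sigma_field M MX X MY Y G"
    and "complete_class M X MY Y (central_class M MX X G)"
  shows "L2_closure (distr M MX X)
      ((\<lambda>f. L2_adjoint (distr M MX X) (distr M MY Y) (cond_exp_op M MX X evX MY Y evY)
              (cond_exp_op M MX X evX MY Y evY f)) ` L2 (distr M MX X))
    = central_class M MX X G"
proof -
  interpret prob_space M by fact
  interpret two_covariance_settings M MX X evX MY Y evY
    by unfold_locales (use assms in blast)+
  show ?thesis
    using closure_range_eq_central_class assms unfolding central_sigma_field_def by blast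
qed

end
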